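(* There exists an absolute constant $c>0$ such that for every positive integer $n$, every non-constant function $f\colon\{0,1\}^n\to\{0,1\}$ and every $2$-coloring $\mathrm{col}\colon E(\{0,1\}^n)\to\{\mathrm{red},\mathrm{blue}\}$ of the edges of the hypercube, both of the following hold: $$\mathrm{Talagrand}_{\mathrm{col}}(f)\;\geq\; c\cdot \mathrm{var}(f)\sqrt{\log\left(\frac{1}{\mathrm{var}(f)}\right)}$$ and $$\mathrm{Talagrand}_{\mathrm{col}}(f)\;\geq\; c\cdot \mathrm{var}(f)\sqrt{\log\left(1+\frac{1}{\sum_{i=1}^{n} I_i[f]^2}\right)}.$$
   Context: Here $x$ is uniformly distributed over $\{0,1\}^n$, $\log$ is the base-$2$ logarithm, and $\mathrm{var}(f)=\mathbb{E}_x[f(x)^2]-\mathbb{E}_x[f(x)]^2$. $E(\{0,1\}^n)$ is the set of edges $\{x,x\oplus e_i\}$ of the hypercube, where $x\oplus e_i$ is $x$ with its $i$th bit flipped. An edge $\{x,x\oplus e_i\}$ is sensitive if $f(x)\ne f(x\oplus e_i)$. The influence of coordinate $i$ is $I_i[f]=\Pr_x[f(x)\neq f(x\oplus e_i)]$. The red sensitivity is $s_{f,\mathrm{red}}(x)=0$ if $f(x)=0$, and otherwise $s_{f,\mathrm{red}}(x)$ is the number of sensitive edges adjacent to $x$ that are red. The blue sensitivity is $s_{f,\mathrm{blue}}(x)=0$ if $f(x)=1$, and otherwise $s_{f,\mathrm{blue}}(x)$ is the number of sensitive edges adjacent to $x$ that are blue. Finally, $$\mathrm{Talagrand}_{\mathrm{col}}(f)=\mathbb{E}_x\left[\sqrt{s_{f,\mathrm{red}}(x)}\right]+\mathbb{E}_x\left[\sqrt{s_{f,\mathrm{blue}}(x)}\right].$$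 *)

theory Defs
  imports "HOL-Probability.Probability"
begin

text \<open>
  The bits 0 and 1 are rendered as \<^const>\<open>False\<close> and \<^const>\<open>True\<close>, and coordinates are numbered
  from 0 to \<open>n - 1\<close>. Since the dimension is quantified inside the main statement, points are
  functions on \<open>nat\<close> that are \<^const>\<open>undefined\<close> outside \<open>{..<n}\<close>; values of a function on
  points outside \<open>cube n\<close>, or of a colouring outside \<open>cube_edges n\<close>, are never used.
\<close>

definition cube :: "nat \<Rightarrow> (nat \<Rightarrow> bool) set" where
  "cube n = {..<n} \<rightarrow>\<^sub>E UNIV"

lemma finite_cube: "finite (cube n)"
  by (simp add: cube_def finite_PiE)

lemma cube_nonempty: "cube n \<noteq> {}"
  by (simp add: cube_def PiE_eq_empty_iff)

definition flip_coord :: "nat \<Rightarrow> (nat \<Rightarrow> bool) \<Rightarrow> nat \<Rightarrow> bool" where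
  "flip_coord i x = x(i := \<not> x i)"

lemma flip_coord_in_cube: "x \<in> cube n \<Longrightarrow> i < n \<Longrightarrow> flip_coord i x \<in> cube n"
  by (auto simp: cube_def flip_coord_def PiE_iff extensional_def)

definition cube_edges :: "nat \<Rightarrow> (nat \<Rightarrow> bool) set set" where
  "cube_edges n = {{x, flip_coord i x} | x i. x \<in> cube n \<and> i < n}"

definition uniform_cube :: "nat \<Rightarrow> (nat \<Rightarrow> bool) pmf" where
  "uniform_cube n = pmf_of_set (cube n)"

abbreviation cube_expectation :: "nat \<Rightarrow> ((nat \<Rightarrow> bool) \<Rightarrow> real) \<Rightarrow> real" where
  "cube_expectation n \<equiv> measure_pmf.expectation (uniform_cube n)"

definition cube_var :: "nat \<Rightarrow> ((nat \<Rightarrow> bool) \<Rightarrow> bool) \<Rightarrow> real" where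
  "cube_var n f =
     cube_expectation n (\<lambda>x. (of_bool (f x))\<^sup>2) - (cube_expectation n (\<lambda>x. of_bool (f x)))\<^sup>2"

definition influence :: "nat \<Rightarrow> ((nat \<Rightarrow> bool) \<Rightarrow> bool) \<Rightarrow> nat \<Rightarrow> real" where
  "influence n f i = measure_pmf.prob (uniform_cube n) {x. f x \<noteq> f (flip_coord i x)}"

definition sensitive_edges :: "nat \<Rightarrow> ((nat \<Rightarrow> bool) \<Rightarrow> bool) \<Rightarrow> (nat \<Rightarrow> bool) set set" where
  "sensitive_edges n f = {e \<in> cube_edges n. \<exists>x y. e = {x, y} \<and> f x \<noteq> f y}"

datatype edge_color = Red | Blue

type_synonym coloring = "(nat \<Rightarrow> bool) set \<Rightarrow> edge_color"

definition red_sensitivity ::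
    "nat \<Rightarrow> coloring \<Rightarrow> ((nat \<Rightarrow> bool) \<Rightarrow> bool) \<Rightarrow> (nat \<Rightarrow> bool) \<Rightarrow> nat" where
  "red_sensitivity n col f x =
     (if f x = False then 0 else card {e \<in> sensitive_edges n f. x \<in> e \<and> col e = Red})"

definition blue_sensitivity ::
    "nat \<Rightarrow> coloring \<Rightarrow> ((nat \<Rightarrow> bool) \<Rightarrow> bool) \<Rightarrow> (nat \<Rightarrow> bool) \<Rightarrow> nat" where
  "blue_sensitivity n col f x =
     (if f x = True then 0 else card {e \<in> sensitive_edges n f. x \<in> e \<and> col e = Blue})"

definition talagrand_col :: "nat \<Rightarrow> coloring \<Rightarrow> ((nat \<Rightarrow> bool) \<Rightarrow> bool) \<Rightarrow> real" where
  "talagrand_col n col f =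
     cube_expectation n (\<lambda>x. sqrt (real (red_sensitivity n col f x)))
     + cube_expectation n (\<lambda>x. sqrt (real (blue_sensitivity n col f x)))"

end

(* Let J be a random set of coordinates, each taken with probability d, and average the red and the
   blue signed gradient of f over the coordinates in J. Since an edge is seen from only one of its
   endpoints in each colour, the two averages add up to the vector of degree-one Fourier coefficients
   of the restriction of f to J, whose length is at most 1. Convexity of the norm and concavity of the
   square root then bound the expected squared length of this vector by sqrt d * Talagrand_col(f), and
   integrating over d gives
     sum_S fhat(S)^2 (1 - (1 - d)^|S|) <= 2 sqrt d Talagrand_col(f).
   It remains to see that little Fourier weight lies below a level of order log (1 / var f), respectively
   log (1 / sum_i I_i^2). Both bounds come from the (2,4)-hypercontractive inequality; for the second it
   is applied to the degree-one coefficients of random restrictions, viewed as functions of the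
   restriction. When var f is smaller than a power of sum_i I_i^2, the second claim follows
   from the first. *)

theory Submission
  imports Defs
begin

section \<open>Averages over the subsets of a finite set\<close>

text \<open>Points of the cube are encoded as subsets of \<open>N\<close>, namely the coordinates
  equal to 1. Flipping coordinate \<open>i\<close> is then \<open>sym_diff X {i}\<close>, and
  induction on the dimension is induction on the finite set \<open>N\<close>.\<close>

definition avg :: "'a set \<Rightarrow> ('a set \<Rightarrow> real) \<Rightarrow> real" where
  "avg N h = (\<Sum>X\<in>Pow N. h X) / 2 ^ card N"

lemma avg_cong: "(\<And>X. X \<subseteq> N \<Longrightarrow> g X = h X) \<Longrightarrow> avg N g = avg N h"
  by (auto simp: avg_def intro!: sum.cong)

lemma avg_mono: "(\<And>X. X \<subseteq> N \<Longrightarrow> g X \<le> h X) \<Longrightarrow> avg N g \<le> avg N h"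
  by (auto simp: avg_def intro!: sum_mono divide_right_mono)

lemma avg_nonneg: "(\<And>X. X \<subseteq> N \<Longrightarrow> 0 \<le> h X) \<Longrightarrow> 0 \<le> avg N h"
  by (auto simp: avg_def intro!: sum_nonneg divide_nonneg_nonneg)

lemma avg_const: "finite N \<Longrightarrow> avg N (\<lambda>_. c) = c"
  by (simp add: avg_def card_Pow)

lemma avg_add: "avg N (\<lambda>X. g X + h X) = avg N g + avg N h"
  by (simp add: avg_def sum.distrib add_divide_distrib)

lemma avg_cmult: "avg N (\<lambda>X. c * h X) = c * avg N h"
  by (simp add: avg_def sum_distrib_left)

lemma avg_sum: "avg N (\<lambda>X. \<Sum>i\<in>I. h i X) = (\<Sum>i\<in>I. avg N (h i))"
  unfolding avg_def by (subst sum.swap) (simp add: sum_divide_distrib)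

lemma avg_swap: "avg N (\<lambda>X. avg M (\<lambda>Y. h X Y)) = avg M (\<lambda>Y. avg N (\<lambda>X. h X Y))"
  unfolding avg_def sum_divide_distrib[symmetric]
  by (subst sum.swap) (simp add: mult.commute)

lemma abs_avg_le: "\<bar>avg N h\<bar> \<le> avg N (\<lambda>X. \<bar>h X\<bar>)"
  by (simp add: avg_def abs_divide divide_right_mono)

lemma sum_Pow_insert:
  assumes "finite N" "a \<notin> N"
  shows "(\<Sum>X\<in>Pow (insert a N). h X) = (\<Sum>X\<in>Pow N. h X) + (\<Sum>X\<in>Pow N. h (insert a X))"
proof -
  have "inj_on (insert a) (Pow N)"
    using assms(2) by (auto simp: inj_on_def)
  moreover have "Pow N \<inter> insert a ` Pow N = {}"
    using assms(2) by auto
  ultimately show ?thesis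
    using assms(1) by (simp add: Pow_insert sum.union_disjoint sum.reindex)
qed

lemma avg_insert:
  assumes "finite N" "a \<notin> N"
  shows "avg (insert a N) h = (avg N h + avg N (\<lambda>X. h (insert a X))) / 2"
  using assms by (simp add: avg_def sum_Pow_insert field_simps)

lemma avg_Cauchy_Schwarz:
  "(avg N (\<lambda>X. g X * h X))\<^sup>2 \<le> avg N (\<lambda>X. (g X)\<^sup>2) * avg N (\<lambda>X. (h X)\<^sup>2)"
proof -
  have "(\<Sum>X\<in>Pow N. g X * h X)\<^sup>2 \<le> (\<Sum>X\<in>Pow N. (g X)\<^sup>2) * (\<Sum>X\<in>Pow N. (h X)\<^sup>2)"
    by (rule Cauchy_Schwarz_ineq_sum)
  then show ?thesis
    by (simp add: avg_def power_divide divide_right_mono power2_eq_square[of "2 ^ card N"])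
qed

lemma avg_le_sqrt:
  assumes "finite N"
  shows "avg N h \<le> sqrt (avg N (\<lambda>X. (h X)\<^sup>2))"
  using avg_Cauchy_Schwarz[of N h "\<lambda>_. 1"] assms
  by (intro real_le_rsqrt) (simp add: avg_const)

lemma bij_betw_sym_diff:
  assumes "K \<subseteq> N"
  shows "bij_betw (\<lambda>X. sym_diff X K) (Pow N) (Pow N)"
  by (rule bij_betw_byWitness[where f' = "\<lambda>X. sym_diff X K"]) (use assms in auto)

lemma avg_sym_diff:
  assumes "K \<subseteq> N"
  shows "avg N (\<lambda>X. h (sym_diff X K)) = avg N h"
  unfolding avg_def
  using sum.reindex_bij_betw[OF bij_betw_sym_diff[OF assms], of h] by simp

text \<open>The orthogonality of characters and the probabilities attached to random sets of
  coordinates are both read off from this product formula.\<close>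

lemma sum_Pow_prod:
  fixes a b :: "'a \<Rightarrow> real"
  assumes "finite N"
  shows "(\<Sum>X\<in>Pow N. \<Prod>k\<in>N. if k \<in> X then a k else b k) = (\<Prod>k\<in>N. a k + b k)"
proof -
  have "(\<Prod>k\<in>N. if k \<in> X then a k else b k) = (\<Prod>k\<in>X. a k) * (\<Prod>k\<in>N - X. b k)"
    if "X \<in> Pow N" for X
  proof -
    have "N \<inter> {k. k \<in> X} = X" "N \<inter> - {k. k \<in> X} = N - X"
      using that by auto
    then show ?thesis
      using assms by (simp add: prod.If_cases)
  qed
  then show ?thesis
    using assms by (simp add: prod_add)
qed

section \<open>Walsh characters, Fourier expansion and hypercontractivity\<close>

text \<open>The Walsh character with frequency \<open>S\<close> at the point \<open>X\<close>.
  Frequencies and points are both subsets, so they can trade places.\<close>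

definition chi :: "'a set \<Rightarrow> 'a set \<Rightarrow> real" where
  "chi S X = (-1) ^ card (S \<inter> X)"

lemma chi_commute: "chi S X = chi X S"
  by (simp add: chi_def Int_commute)

lemma chi_empty [simp]: "chi {} X = 1" "chi X {} = 1"
  by (simp_all add: chi_def)

lemma chi_singleton: "chi {i} X = (if i \<in> X then -1 else 1)"
  by (simp add: chi_def)

lemma chi_mult_self [simp]: "chi S X * chi S X = 1"
  by (simp add: chi_def flip: power_add)

lemma chi_power2 [simp]: "(chi S X)\<^sup>2 = 1"
  by (simp add: power2_eq_square)

lemma abs_chi [simp]: "\<bar>chi S X\<bar> = 1"
  by (simp add: chi_def power_abs)

lemma chi_eq_prod:
  assumes "finite N" "S \<subseteq> N"
  shows "chi S X = (\<Prod>k\<in>N. if k \<in> X then (if k \<in> S then -1 else 1) else 1)"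
proof -
  have "(\<Prod>k\<in>N. if k \<in> X then (if k \<in> S then -1 else 1) else 1 :: real)
      = (\<Prod>k\<in>N. if k \<in> S \<inter> X then -1 else 1)"
    by (rule prod.cong) auto
  also have "\<dots> = (\<Prod>k\<in>S \<inter> X. -1)"
    using assms by (subst prod.inter_restrict[symmetric]) (auto simp: Int_absorb1 le_infI1)
  finally show ?thesis
    by (simp add: chi_def)
qed

lemma chi_sym_diff:
  assumes "finite S"
  shows "chi S (sym_diff X Y) = chi S X * chi S Y"
  unfolding chi_eq_prod[OF assms subset_refl] prod.distrib[symmetric]
  by (rule prod.cong) auto

lemma chi_mult_chi:
  assumes "finite X"
  shows "chi S X * chi T X = chi (sym_diff S T) X"
  using chi_sym_diff[OF assms, of S T] by (simp add: chi_commute)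

lemma chi_insert_left:
  assumes "finite X" "a \<notin> S"
  shows "chi (insert a S) X = (if a \<in> X then -1 else 1) * chi S X"
proof -
  have "sym_diff {a} S = insert a S"
    using assms(2) by auto
  then show ?thesis
    using chi_mult_chi[OF assms(1), of "{a}" S] by (simp add: chi_singleton)
qed

text \<open>A coordinate in \<open>S \<inter> N\<close> contributes the factor -1 + 1 = 0 to the
  sum. \<open>S\<close> may stick out of \<open>N\<close> because characters of the whole cube are
  later averaged over a subcube only.\<close>

lemma avg_chi:
  assumes "finite N"
  shows "avg N (chi S) = (if S \<inter> N = {} then 1 else 0)"
proof -
  have "chi S X = chi (S \<inter> N) X" if "X \<subseteq> N" for X
    using that by (simp add: chi_def Int_assoc Int_absorb1)
  then have *: "avg N (chi S) = avg N (chi (S \<inter> N))"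
    by (rule avg_cong)
  show ?thesis
  proof (cases "S \<inter> N = {}")
    case False
    then obtain k where "k \<in> S" "k \<in> N" by blast
    have "(\<Sum>X\<in>Pow N. chi (S \<inter> N) X) = (\<Prod>k\<in>N. (if k \<in> S \<inter> N then -1 else 1) + 1)"
      unfolding chi_eq_prod[OF assms Int_lower2] by (rule sum_Pow_prod[OF assms])
    also have "\<dots> = 0"
      using \<open>k \<in> S\<close> \<open>k \<in> N\<close> assms by (intro prod_zero) auto
    finally show ?thesis
      using False * by (simp add: avg_def)
  next
    case True
    moreover have "avg N (chi {}) = 1"
      using assms by (simp add: avg_def card_Pow)
    ultimately show ?thesis
      unfolding * by simp
  qed
qed

definition synth :: "'a set \<Rightarrow> ('a set \<Rightarrow> real) \<Rightarrow> 'a set \<Rightarrow> real" where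
  "synth N c X = (\<Sum>S\<in>Pow N. c S * chi S X)"

definition fourier :: "'a set \<Rightarrow> ('a set \<Rightarrow> real) \<Rightarrow> 'a set \<Rightarrow> real" where
  "fourier N f S = avg N (\<lambda>X. f X * chi S X)"

text \<open>After exchanging the sums, the inner sum over the frequencies is the mean of a character
  with the roles of point and frequency swapped, and it vanishes unless
  \<open>Y = X\<close>.\<close>

lemma synth_fourier:
  assumes "finite N" "X \<subseteq> N"
  shows "synth N (fourier N f) X = f X"
proof -
  have fin: "finite X" "\<And>Y. Y \<subseteq> N \<Longrightarrow> finite Y"
    using assms by (auto intro: finite_subset)
  have "synth N (fourier N f) X = (\<Sum>S\<in>Pow N. \<Sum>Y\<in>Pow N. f Y * (chi S Y * chi S X)) / 2 ^ card N"
    by (simp add: synth_def fourier_def avg_def sum_distrib_right sum_divide_distrib mult.assoc)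
  also have "\<dots> = (\<Sum>Y\<in>Pow N. \<Sum>S\<in>Pow N. f Y * (chi S Y * chi S X)) / 2 ^ card N"
    by (subst sum.swap) simp
  also have "\<dots> = (\<Sum>Y\<in>Pow N. f Y * avg N (chi (sym_diff Y X)))"
    unfolding avg_def sum_divide_distrib sum_distrib_left
    by (intro sum.cong refl) (simp add: chi_commute[of "sym_diff _ _"] chi_sym_diff fin)
  also have "\<dots> = (\<Sum>Y\<in>Pow N. f Y * (if sym_diff Y X = {} then 1 else 0))"
    by (intro sum.cong refl, subst avg_chi) (use assms in auto)
  also have "\<dots> = (\<Sum>Y\<in>Pow N. if Y = X then f Y else 0)"
    by (intro sum.cong) auto
  also have "\<dots> = f X"
    using assms by (simp add: sum.delta)
  finally show ?thesis .
qed

lemma avg_synth_mult: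
  assumes "finite N"
  shows "avg N (\<lambda>X. synth N c X * synth N d X) = (\<Sum>S\<in>Pow N. c S * d S)"
proof -
  have "avg N (\<lambda>X. synth N c X * synth N d X)
      = avg N (\<lambda>X. \<Sum>S\<in>Pow N. \<Sum>T\<in>Pow N. (c S * d T) * chi (sym_diff S T) X)"
    by (rule avg_cong)
      (simp add: synth_def sum_product finite_subset[OF _ assms] chi_mult_chi[symmetric] mult_ac)
  also have "\<dots> = (\<Sum>S\<in>Pow N. \<Sum>T\<in>Pow N. (c S * d T) * avg N (chi (sym_diff S T)))"
    by (simp add: avg_sum avg_cmult)
  also have "\<dots> = (\<Sum>S\<in>Pow N. \<Sum>T\<in>Pow N. if T = S then c S * d T else 0)"
    by (intro sum.cong refl, subst avg_chi) (use assms in auto)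
  also have "\<dots> = (\<Sum>S\<in>Pow N. c S * d S)"
    using assms by (simp add: sum.delta)
  finally show ?thesis .
qed

lemma parseval:
  assumes "finite N"
  shows "(\<Sum>S\<in>Pow N. (fourier N f S)\<^sup>2) = avg N (\<lambda>X. (f X)\<^sup>2)"
  using avg_synth_mult[OF assms, of "fourier N f" "fourier N f"]
  by (simp add: power2_eq_square synth_fourier[OF assms] cong: avg_cong)

text \<open>Bessel's inequality: the singletons give some of the terms of Parseval's
  identity.\<close>

lemma fourier_singletons_le:
  assumes "finite J"
  shows "(\<Sum>i\<in>J. (fourier J f {i})\<^sup>2) \<le> avg J (\<lambda>X. (f X)\<^sup>2)"
proof -
  have "(\<Sum>i\<in>J. (fourier J f {i})\<^sup>2) = (\<Sum>S\<in>(\<lambda>i. {i}) ` J. (fourier J f S)\<^sup>2)"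
    by (simp add: sum.reindex)
  also have "\<dots> \<le> (\<Sum>S\<in>Pow J. (fourier J f S)\<^sup>2)"
    using assms by (intro sum_mono2) auto
  finally show ?thesis
    by (simp add: parseval[OF assms])
qed

text \<open>Hypercontractivity from exponent 2 to exponent 4: expanding the fourth power along one coordinate
  gives \<open>h0^4 + 2 h0^2 h1^2 + h1^4 / 9\<close>, whose mean is at most \<open>(a + b)^2\<close>.\<close>

lemma bonami:
  assumes "finite N"
  shows "avg N (\<lambda>X. (synth N (\<lambda>S. (1 / sqrt 3) ^ card S * c S) X) ^ 4) \<le> (\<Sum>S\<in>Pow N. (c S)\<^sup>2)\<^sup>2"
  using assms
proof (induction N arbitrary: c rule: finite_induct)
  case empty
  then show ?case
    by (simp add: avg_def synth_def)
next
  case (insert a N)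
  define r :: real where "r = 1 / sqrt 3"
  have r2: "r ^ 2 = 1 / 3" by (simp add: r_def power_divide)
  have r4: "r ^ 4 = 1 / 9"
    using arg_cong[OF r2, of "\<lambda>x. x\<^sup>2"] by (simp add: power_divide)
  define c1 where "c1 = (\<lambda>S. c (insert a S))"
  define h0 where "h0 = synth N (\<lambda>S. r ^ card S * c S)"
  define h1 where "h1 = synth N (\<lambda>S. r ^ card S * c1 S)"
  define A where "A = (\<Sum>S\<in>Pow N. (c S)\<^sup>2)"
  define B where "B = (\<Sum>S\<in>Pow N. (c1 S)\<^sup>2)"
  have AB: "A \<ge> 0" "B \<ge> 0"
    by (auto simp: A_def B_def intro: sum_nonneg)
  have fin: "finite X" if "X \<subseteq> N" for X
    using that insert.hyps(1) by (rule finite_subset)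
  have ni: "a \<notin> X" if "X \<subseteq> N" for X
    using that insert.hyps(2) by blast
  \<comment> \<open>Splitting the frequencies by whether they contain \<open>a\<close> turns the
    function into \<open>h0 + r * h1\<close> where coordinate \<open>a\<close> is 0, and into
    \<open>h0 - r * h1\<close> where it is 1.\<close>
  have E: "synth (insert a N) (\<lambda>S. r ^ card S * c S) X
      = synth N (\<lambda>S. r ^ card S * c S) X + (\<Sum>S\<in>Pow N. r * (r ^ card S * c1 S) * chi (insert a S) X)" for X
    unfolding synth_def sum_Pow_insert[OF insert.hyps]
    by (intro arg_cong2[where f = "(+)"] refl sum.cong) (simp add: c1_def fin ni mult.assoc)
  have E0: "synth (insert a N) (\<lambda>S. r ^ card S * c S) X = h0 X + r * h1 X" if X: "X \<subseteq> N" for X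
    unfolding E unfolding h0_def h1_def synth_def sum_distrib_left
    by (intro arg_cong2[where f = "(+)"] refl sum.cong)
      (use ni[OF X] ni in \<open>simp add: chi_insert_left fin[OF X] mult.assoc\<close>)
  have chi_ins: "chi S (insert a X) = chi S X" if "S \<subseteq> N" for S X
    using ni[OF that] by (simp add: chi_def)
  have E1: "synth (insert a N) (\<lambda>S. r ^ card S * c S) (insert a X) = h0 X - r * h1 X"
    if X: "X \<subseteq> N" for X
  proof -
    have "h0 X = synth N (\<lambda>S. r ^ card S * c S) (insert a X)"
      unfolding h0_def synth_def by (intro sum.cong refl) (simp add: chi_ins)
    moreover have "- (r * h1 X) = (\<Sum>S\<in>Pow N. r * (r ^ card S * c1 S) * chi (insert a S) (insert a X))"
      unfolding h1_def synth_def sum_distrib_left sum_negf[symmetric]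
      by (intro sum.cong refl)
        (use ni[OF X] ni in \<open>simp add: chi_insert_left fin[OF X] chi_ins mult.assoc\<close>)
    ultimately show ?thesis
      unfolding E by simp
  qed
  have IH0: "avg N (\<lambda>X. h0 X ^ 4) \<le> A\<^sup>2"
    using insert.IH[of c] by (simp add: h0_def A_def r_def)
  have IH1: "avg N (\<lambda>X. h1 X ^ 4) \<le> B\<^sup>2"
    using insert.IH[of c1] by (simp add: h1_def B_def r_def)
  have mixed: "avg N (\<lambda>X. (h0 X)\<^sup>2 * (h1 X)\<^sup>2) \<le> A * B"
  proof (rule power2_le_imp_le)
    have "(avg N (\<lambda>X. (h0 X)\<^sup>2 * (h1 X)\<^sup>2))\<^sup>2 \<le> avg N (\<lambda>X. h0 X ^ 4) * avg N (\<lambda>X. h1 X ^ 4)"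
      using avg_Cauchy_Schwarz[of N "\<lambda>X. (h0 X)\<^sup>2" "\<lambda>X. (h1 X)\<^sup>2"] by simp
    also have "\<dots> \<le> A\<^sup>2 * B\<^sup>2"
      by (intro mult_mono IH0 IH1 avg_nonneg) auto
    finally show "(avg N (\<lambda>X. (h0 X)\<^sup>2 * (h1 X)\<^sup>2))\<^sup>2 \<le> (A * B)\<^sup>2"
      by (simp add: power_mult_distrib)
  qed (use AB in simp)
  have "avg (insert a N) (\<lambda>X. (synth (insert a N) (\<lambda>S. r ^ card S * c S) X) ^ 4)
      = (avg N (\<lambda>X. (h0 X + r * h1 X) ^ 4) + avg N (\<lambda>X. (h0 X - r * h1 X) ^ 4)) / 2"
    unfolding avg_insert[OF insert.hyps] using E0 E1 by (simp cong: avg_cong)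
  also have "\<dots> = avg N (\<lambda>X. h0 X ^ 4 + 2 * ((h0 X)\<^sup>2 * (h1 X)\<^sup>2) + 1 / 9 * h1 X ^ 4)"
  proof -
    have "(h0 X + r * h1 X) ^ 4 + (h0 X - r * h1 X) ^ 4
        = 2 * (h0 X ^ 4 + 6 * r ^ 2 * ((h0 X)\<^sup>2 * (h1 X)\<^sup>2) + r ^ 4 * h1 X ^ 4)" for X
      by algebra
    then show ?thesis
      unfolding avg_add[symmetric] by (simp only: r2 r4 avg_cmult) simp
  qed
  also have "\<dots> \<le> A\<^sup>2 + 2 * (A * B) + B\<^sup>2"
  proof -
    have "0 \<le> avg N (\<lambda>X. h1 X ^ 4)"
      by (intro avg_nonneg) simp
    then show ?thesis
      unfolding avg_add avg_cmult using IH0 IH1 mixed by linarith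
  qed
  also have "\<dots> = (A + B)\<^sup>2"
    by algebra
  also have "A + B = (\<Sum>S\<in>Pow (insert a N). (c S)\<^sup>2)"
    by (simp add: A_def B_def c1_def sum_Pow_insert[OF insert.hyps])
  finally show ?case
    by (simp only: r_def)
qed

section \<open>Degree-one Fourier coefficients of restrictions\<close>

text \<open>The Fourier coefficient at \<open>R\<close> of \<open>restricted_fourier f J i\<close>,
  regarded as a function of the point that fixes the coordinates outside \<open>J\<close>.\<close>

definition restricted_coeff :: "'a set \<Rightarrow> ('a set \<Rightarrow> real) \<Rightarrow> 'a set \<Rightarrow> 'a \<Rightarrow> 'a set \<Rightarrow> real" where
  "restricted_coeff N f J i R = (if R \<inter> J = {} then fourier N f (insert i R) else 0)"

text \<open>The coefficient at \<open>{i}\<close> of the restriction of \<open>f\<close> to the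
  coordinates in \<open>J\<close>, the others being fixed as in \<open>X\<close>. Averaging over all
  \<open>K \<subseteq> J\<close> removes the dependence on \<open>X \<inter> J\<close>, so this is a
  function on the whole cube and Fourier analysis over \<open>N\<close> applies to it.\<close>

definition restricted_fourier :: "('a set \<Rightarrow> real) \<Rightarrow> 'a set \<Rightarrow> 'a \<Rightarrow> 'a set \<Rightarrow> real" where
  "restricted_fourier f J i X = avg J (\<lambda>K. f (sym_diff X K) * chi {i} (sym_diff X K))"

text \<open>Each character at \<open>sym_diff X K\<close> factors into one of \<open>X\<close> and
  one of \<open>K\<close>. The average over \<open>K\<close> keeps only frequencies \<open>S\<close>
  with \<open>sym_diff S {i}\<close> disjoint from \<open>J\<close>; as \<open>i \<in> J\<close>,
  such an \<open>S\<close> is \<open>insert i R\<close> with \<open>R\<close> disjoint from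
  \<open>J\<close>.\<close>

lemma restricted_fourier_eq_synth:
  assumes "finite N" "J \<subseteq> N" "i \<in> J" "X \<subseteq> N"
  shows "restricted_fourier f J i X = synth N (restricted_coeff N f J i) X"
proof -
  have finJ: "finite J"
    using assms finite_subset by blast
  have fin: "finite Y" if "Y \<subseteq> N" for Y
    using that assms(1) by (rule finite_subset)
  have "f (sym_diff X K) * chi {i} (sym_diff X K)
      = (\<Sum>S\<in>Pow N. (fourier N f S * chi (sym_diff S {i}) X) * chi (sym_diff S {i}) K)"
    if K: "K \<subseteq> J" for K
  proof -
    have XK: "sym_diff X K \<subseteq> N"
      using K assms by blast
    have "f (sym_diff X K) * chi {i} (sym_diff X K)
        = synth N (fourier N f) (sym_diff X K) * chi {i} (sym_diff X K)"
      using synth_fourier[OF assms(1) XK] by simp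
    also have "\<dots> = (\<Sum>S\<in>Pow N. fourier N f S * (chi S (sym_diff X K) * chi {i} (sym_diff X K)))"
      by (simp add: synth_def sum_distrib_right mult.assoc)
    also have "\<dots> = (\<Sum>S\<in>Pow N. (fourier N f S * chi (sym_diff S {i}) X) * chi (sym_diff S {i}) K)"
      unfolding chi_mult_chi[OF fin[OF XK]]
      by (intro sum.cong refl) (simp add: fin chi_sym_diff)
    finally show ?thesis .
  qed
  then have "restricted_fourier f J i X
      = (\<Sum>S\<in>Pow N. (fourier N f S * chi (sym_diff S {i}) X) * avg J (chi (sym_diff S {i})))"
    unfolding restricted_fourier_def by (simp add: avg_sum avg_cmult cong: avg_cong)
  also have "\<dots> = (\<Sum>S\<in>Pow N. (fourier N f (sym_diff S {i}) * chi S X) * avg J (chi S))"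
    by (subst sum.reindex_bij_betw[OF bij_betw_sym_diff, symmetric, of "{i}"])
      (use assms in \<open>auto intro!: sum.cong arg_cong2[where f = "(*)"] arg_cong[where f = "fourier N f"]\<close>)
  also have "\<dots> = synth N (restricted_coeff N f J i) X"
    unfolding synth_def
  proof (intro sum.cong refl)
    fix S assume "S \<in> Pow N"
    show "fourier N f (sym_diff S {i}) * chi S X * avg J (chi S) = restricted_coeff N f J i S * chi S X"
    proof (cases "S \<inter> J = {}")
      case True
      then have "sym_diff S {i} = insert i S"
        using assms(3) by auto
      then show ?thesis
        using True by (simp add: restricted_coeff_def avg_chi[OF finJ])
    qed (simp add: restricted_coeff_def avg_chi[OF finJ])
  qed
  finally show ?thesis .
qed

text \<open>Up to the sign \<open>chi {i} X\<close> these are the degree-one coefficients of a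
  function bounded by 1 on the cube over \<open>J\<close>, so Bessel's inequality applies.\<close>

lemma sum_restricted_fourier_le_1:
  assumes "finite J" "\<And>K. K \<subseteq> J \<Longrightarrow> \<bar>f (sym_diff X K)\<bar> \<le> 1"
  shows "(\<Sum>i\<in>J. (restricted_fourier f J i X)\<^sup>2) \<le> 1"
proof -
  have "(restricted_fourier f J i X)\<^sup>2 = (fourier J (\<lambda>K. f (sym_diff X K)) {i})\<^sup>2" for i
  proof -
    have "restricted_fourier f J i X = chi {i} X * fourier J (\<lambda>K. f (sym_diff X K)) {i}"
      unfolding restricted_fourier_def fourier_def avg_cmult[symmetric]
      by (simp add: chi_sym_diff mult_ac)
    then show ?thesis
      by (simp add: power_mult_distrib)
  qed
  then have "(\<Sum>i\<in>J. (restricted_fourier f J i X)\<^sup>2) \<le> avg J (\<lambda>K. (f (sym_diff X K))\<^sup>2)"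
    using fourier_singletons_le[OF assms(1)] by simp
  also have "\<dots> \<le> avg J (\<lambda>_. 1)"
    using assms(2) by (intro avg_mono) (simp add: abs_square_le_1)
  finally show ?thesis
    using assms(1) by (simp add: avg_const)
qed

lemma avg_restricted_fourier_sq:
  assumes "finite N" "J \<subseteq> N"
  shows "avg N (\<lambda>X. \<Sum>i\<in>J. (restricted_fourier f J i X)\<^sup>2)
    = (\<Sum>i\<in>J. \<Sum>R\<in>Pow N. (restricted_coeff N f J i R)\<^sup>2)"
  unfolding avg_sum power2_eq_square
  by (intro sum.cong refl)
    (simp add: restricted_fourier_eq_synth[OF assms] avg_synth_mult[OF assms(1)] cong: avg_cong)

lemma avg_translate:
  assumes "i \<in> J"
  shows "avg J (\<lambda>K. h (sym_diff (sym_diff X K) {i})) = avg J (\<lambda>K. h (sym_diff X K))"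
proof -
  have "sym_diff (sym_diff X K) {i} = sym_diff X (sym_diff K {i})" for K
    by auto
  then show ?thesis
    using avg_sym_diff[of "{i}" J "\<lambda>K. h (sym_diff X K)"] assms by simp
qed

text \<open>Flipping coordinate \<open>i\<close> preserves the average over \<open>J\<close> and
  changes the sign of \<open>chi {i}\<close>. The mean of the two resulting expressions is a signed
  discrete derivative.\<close>

lemma restricted_fourier_diff:
  assumes "i \<in> J" "finite J"
  shows "restricted_fourier f J i X
    = avg J (\<lambda>K. chi {i} (sym_diff X K) * (f (sym_diff X K) - f (sym_diff (sym_diff X K) {i}))) / 2"
proof -
  define h where "h Y = f Y * chi {i} Y" for Y
  have "chi {i} Y * (f Y - f (sym_diff Y {i})) = h Y + h (sym_diff Y {i})" for Y
    by (simp add: h_def chi_sym_diff chi_singleton algebra_simps)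
  then show ?thesis
    using avg_translate[OF assms(1), of h X]
    by (simp add: avg_add restricted_fourier_def h_def)
qed

lemma avg_avg_sym_diff:
  assumes "finite J" "J \<subseteq> N"
  shows "avg N (\<lambda>X. avg J (\<lambda>K. h (sym_diff X K))) = avg N h"
proof -
  have "avg N (\<lambda>X. avg J (\<lambda>K. h (sym_diff X K))) = avg J (\<lambda>K. avg N (\<lambda>X. h (sym_diff X K)))"
    by (rule avg_swap)
  also have "\<dots> = avg J (\<lambda>K. avg N h)"
    by (rule avg_cong, rule avg_sym_diff) (use assms in auto)
  finally show ?thesis
    using assms by (simp add: avg_const)
qed

text \<open>Averaging does not increase the mean absolute value of the discrete derivative; the
  factor 1/2 from \<open>restricted_fourier_diff\<close> is given away.\<close>

lemma avg_abs_restricted_fourier_le: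
  assumes "finite N" "J \<subseteq> N" "i \<in> J"
  shows "avg N (\<lambda>X. \<bar>restricted_fourier f J i X\<bar>) \<le> avg N (\<lambda>X. \<bar>f X - f (sym_diff X {i})\<bar>)"
proof -
  have finJ: "finite J"
    using assms finite_subset by blast
  have "\<bar>restricted_fourier f J i X\<bar> \<le> avg J (\<lambda>K. \<bar>f (sym_diff X K) - f (sym_diff (sym_diff X K) {i})\<bar>)" for X
  proof -
    have "\<bar>restricted_fourier f J i X\<bar>
        \<le> \<bar>avg J (\<lambda>K. chi {i} (sym_diff X K) * (f (sym_diff X K) - f (sym_diff (sym_diff X K) {i})))\<bar>"
      unfolding restricted_fourier_diff[OF assms(3) finJ] by simp
    also have "\<dots> \<le> avg J (\<lambda>K. \<bar>f (sym_diff X K) - f (sym_diff (sym_diff X K) {i})\<bar>)"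
      by (rule order_trans[OF abs_avg_le]) (simp add: abs_mult)
    finally show ?thesis .
  qed
  then have "avg N (\<lambda>X. \<bar>restricted_fourier f J i X\<bar>)
      \<le> avg N (\<lambda>X. avg J (\<lambda>K. \<bar>f (sym_diff X K) - f (sym_diff (sym_diff X K) {i})\<bar>))"
    by (intro avg_mono)
  also have "\<dots> = avg N (\<lambda>X. \<bar>f X - f (sym_diff X {i})\<bar>)"
    by (rule avg_avg_sym_diff[OF finJ assms(2)])
  finally show ?thesis .
qed

section \<open>Coloured gradients under restriction\<close>

text \<open>Convexity of the Euclidean norm, obtained by iterating the triangle inequality.\<close>

lemma L2_set_avg_le: "L2_set (\<lambda>i. avg J (v i)) I \<le> avg J (\<lambda>K. L2_set (\<lambda>i. v i K) I)"
proof -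
  have "L2_set (\<lambda>i. \<Sum>K\<in>A. v i K) I \<le> (\<Sum>K\<in>A. L2_set (\<lambda>i. v i K) I)" if "finite A" for A
    using that
  proof (induction A rule: finite_induct)
    case (insert K A)
    then show ?case
      using L2_set_triangle_ineq[of "\<lambda>i. v i K" "\<lambda>i. \<Sum>K\<in>A. v i K" I] by simp
  qed (simp add: L2_set_def)
  then have *: "L2_set (\<lambda>i. \<Sum>K\<in>Pow J. v i K) I \<le> (\<Sum>K\<in>Pow J. L2_set (\<lambda>i. v i K) I)"
    \<comment> \<open>For infinite \<open>J\<close> the sums over \<open>Pow J\<close> are 0 by
      convention.\<close>
    by (cases "finite J") (auto simp: L2_set_def)
  have "L2_set (\<lambda>i. avg J (v i)) I = L2_set (\<lambda>i. \<Sum>K\<in>Pow J. v i K) I * (1 / 2 ^ card J)"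
    unfolding avg_def by (subst L2_set_left_distrib) auto
  then show ?thesis
    using * by (simp add: avg_def divide_right_mono)
qed

lemma L2_set_signed_indicator:
  assumes "finite J" "\<And>i. \<bar>c i\<bar> = 1"
  shows "L2_set (\<lambda>i. c i * of_bool (P i)) J = sqrt (real (card {i\<in>J. P i}))"
proof -
  have "(c i * of_bool (P i))\<^sup>2 = of_bool (P i)" for i
    using assms(2)[of i] by (simp add: power_mult_distrib abs_square_eq_1)
  then show ?thesis
    using assms(1) by (simp add: L2_set_def Int_def)
qed

text \<open>A sensitive edge in direction \<open>i\<close> is counted by exactly one of \<open>red i\<close> and \<open>blue i\<close>, at exactly
  one of its endpoints, which is what the hypothesis on \<open>red\<close> and \<open>blue\<close> encodes. Averaging over the
  coordinates in \<open>J\<close> erases the choice of the endpoint, so the averages of the two signed gradients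
  add up to the first-level Fourier coefficients of the restrictions of \<open>f\<close>.\<close>

lemma coloured_gradient_restriction:
  assumes "finite N" "J \<subseteq> N" and f: "\<And>X. X \<subseteq> N \<Longrightarrow> \<bar>f X\<bar> \<le> 1"
    and col: "\<And>X i. X \<subseteq> N \<Longrightarrow> i \<in> N \<Longrightarrow>
      of_bool (red i X) - of_bool (red i (sym_diff X {i})) - of_bool (blue i X) + of_bool (blue i (sym_diff X {i}))
        = f X - f (sym_diff X {i})"
  shows "(\<Sum>i\<in>J. \<Sum>R\<in>Pow N. (restricted_coeff N f J i R)\<^sup>2)
    \<le> avg N (\<lambda>X. sqrt (real (card {i\<in>J. red i X}))) + avg N (\<lambda>X. sqrt (real (card {i\<in>J. blue i X})))"
proof -
  have finJ: "finite J"
    using assms finite_subset by blast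
  define a where "a i X = chi {i} X * of_bool (red i X)" for i X
  \<comment> \<open>The minus sign is that of \<open>blue\<close> in \<open>col\<close>: with it,
    \<open>a + b\<close> at a point and at its \<open>i\<close>-neighbour sum to the signed
    derivative of \<open>f\<close>.\<close>
  define b where "b i X = - chi {i} X * of_bool (blue i X)" for i X
  have split: "restricted_fourier f J i X = avg J (\<lambda>K. a i (sym_diff X K)) + avg J (\<lambda>K. b i (sym_diff X K))"
    if "X \<subseteq> N" "i \<in> J" for i X
  proof -
    define h where "h Y = a i Y + b i Y" for Y
    have "chi {i} Y * (f Y - f (sym_diff Y {i})) = h Y + h (sym_diff Y {i})" if "Y \<subseteq> N" for Y
    proof -
      have "i \<in> N"
        using \<open>i \<in> J\<close> assms by blast
      then show ?thesis
        unfolding col[OF that \<open>i \<in> N\<close>, symmetric] h_def a_def b_def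
        by (simp add: chi_sym_diff chi_singleton algebra_simps)
    qed
    moreover have "sym_diff X K \<subseteq> N" if "K \<subseteq> J" for K
      using that assms \<open>X \<subseteq> N\<close> by blast
    ultimately have "restricted_fourier f J i X
        = avg J (\<lambda>K. h (sym_diff X K) + h (sym_diff (sym_diff X K) {i})) / 2"
      unfolding restricted_fourier_diff[OF \<open>i \<in> J\<close> finJ] by (simp cong: avg_cong)
    also have "\<dots> = avg J (\<lambda>K. h (sym_diff X K))"
      unfolding avg_add avg_translate[OF \<open>i \<in> J\<close>] by simp
    finally show ?thesis
      by (simp add: h_def avg_add)
  qed
  have "(\<Sum>i\<in>J. (restricted_fourier f J i X)\<^sup>2)
      \<le> avg J (\<lambda>K. sqrt (real (card {i\<in>J. red i (sym_diff X K)})))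
        + avg J (\<lambda>K. sqrt (real (card {i\<in>J. blue i (sym_diff X K)})))" if X: "X \<subseteq> N" for X
  proof -
    let ?s = "\<Sum>i\<in>J. (restricted_fourier f J i X)\<^sup>2"
    have s: "0 \<le> ?s" "?s \<le> 1"
      by (auto intro!: sum_nonneg sum_restricted_fourier_le_1 finJ f) (use X assms in blast)+
    \<comment> \<open>The squared length is at most 1, hence at most the length itself, and the
      length obeys the triangle inequality.\<close>
    have "?s \<le> sqrt ?s"
      by (intro real_le_rsqrt) (use s in \<open>simp add: power2_eq_square mult_left_le\<close>)
    also have "\<dots> = L2_set (\<lambda>i. avg J (\<lambda>K. a i (sym_diff X K)) + avg J (\<lambda>K. b i (sym_diff X K))) J"
      using split[OF X] by (simp add: L2_set_def)
    also have "\<dots> \<le> L2_set (\<lambda>i. avg J (\<lambda>K. a i (sym_diff X K))) J + L2_set (\<lambda>i. avg J (\<lambda>K. b i (sym_diff X K))) J"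
      by (rule L2_set_triangle_ineq)
    also have "\<dots> \<le> avg J (\<lambda>K. L2_set (\<lambda>i. a i (sym_diff X K)) J) + avg J (\<lambda>K. L2_set (\<lambda>i. b i (sym_diff X K)) J)"
      by (intro add_mono L2_set_avg_le)
    finally show ?thesis
      unfolding a_def b_def by (simp only: L2_set_signed_indicator[OF finJ] abs_minus_cancel abs_chi)
  qed
  then have "avg N (\<lambda>X. \<Sum>i\<in>J. (restricted_fourier f J i X)\<^sup>2)
      \<le> avg N (\<lambda>X. avg J (\<lambda>K. sqrt (real (card {i\<in>J. red i (sym_diff X K)})))
        + avg J (\<lambda>K. sqrt (real (card {i\<in>J. blue i (sym_diff X K)}))))"
    by (rule avg_mono)
  then show ?thesis
    unfolding avg_restricted_fourier_sq[OF assms(1,2)] avg_add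
    using avg_avg_sym_diff[OF finJ assms(2), of "\<lambda>X. sqrt (real (card {i\<in>J. red i X}))"]
      avg_avg_sym_diff[OF finJ assms(2), of "\<lambda>X. sqrt (real (card {i\<in>J. blue i X}))"]
    by simp
qed

section \<open>Random sets of coordinates\<close>

text \<open>For \<open>J \<subseteq> N\<close>, the probability that a random subset of
  \<open>N\<close>, containing each element independently with probability \<open>\<delta>\<close>,
  equals \<open>J\<close>.\<close>

definition random_weight :: "'a set \<Rightarrow> real \<Rightarrow> 'a set \<Rightarrow> real" where
  "random_weight N \<delta> J = (\<Prod>k\<in>N. if k \<in> J then \<delta> else 1 - \<delta>)"

lemma random_weight_nonneg: "0 \<le> \<delta> \<Longrightarrow> \<delta> \<le> 1 \<Longrightarrow> 0 \<le> random_weight N \<delta> J"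
  by (simp add: random_weight_def prod_nonneg)

lemma sum_random_weight: "finite N \<Longrightarrow> (\<Sum>J\<in>Pow N. random_weight N \<delta> J) = 1"
  by (simp add: random_weight_def sum_Pow_prod)

lemma sum_random_weight_singleton:
  assumes "finite N" "S \<subseteq> N" "i \<in> S"
  shows "(\<Sum>J\<in>Pow N. random_weight N \<delta> J * of_bool (S \<inter> J = {i})) = \<delta> * (1 - \<delta>) ^ (card S - 1)"
proof -
  \<comment> \<open>The zeros of \<open>a\<close> forbid the other elements of \<open>S\<close> from
    lying in \<open>J\<close>, and the zero of \<open>b\<close> forbids \<open>i\<close> from being
    absent; the product formula then computes the probability.\<close>
  define a where "a k = (if k \<in> S - {i} then 0 else \<delta>)" for k
  define b where "b k = (if k = i then 0 else 1 - \<delta>)" for k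
  have finS: "finite S"
    using assms finite_subset by blast
  have "random_weight N \<delta> J * of_bool (S \<inter> J = {i}) = (\<Prod>k\<in>N. if k \<in> J then a k else b k)" for J
  proof (cases "S \<inter> J = {i}")
    case True
    then show ?thesis
      unfolding random_weight_def by (auto intro!: prod.cong simp: a_def b_def)
  next
    case False
    then consider "i \<notin> J" | k where "k \<in> J" "k \<in> S - {i}"
      using assms(3) by blast
    then have "(\<Prod>k\<in>N. if k \<in> J then a k else b k) = 0"
    proof cases
      case 1
      then show ?thesis
        using assms by (intro prod_zero bexI[of _ i]) (auto simp: b_def)
    next
      case (2 k)
      then show ?thesis
        using assms by (intro prod_zero bexI[of _ k]) (auto simp: a_def)
    qed
    then show ?thesis
      using False by simp
  qed
  then have "(\<Sum>J\<in>Pow N. random_weight N \<delta> J * of_bool (S \<inter> J = {i})) = (\<Prod>k\<in>N. a k + b k)"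
    using assms(1) by (simp add: sum_Pow_prod)
  also have "\<dots> = (\<Prod>k\<in>S. a k + b k)"
    by (rule prod.mono_neutral_right) (use assms in \<open>auto simp: a_def b_def\<close>)
  also have "\<dots> = (a i + b i) * (\<Prod>k\<in>S - {i}. a k + b k)"
    using assms finS by (simp add: prod.remove)
  also have "(\<Prod>k\<in>S - {i}. a k + b k) = (\<Prod>k\<in>S - {i}. 1 - \<delta>)"
    by (rule prod.cong) (auto simp: a_def b_def)
  finally show ?thesis
    using assms finS by (simp add: a_def b_def)
qed

text \<open>A pair \<open>(i, R)\<close> with \<open>i \<in> J\<close> and \<open>R\<close> disjoint
  from \<open>J\<close> is the same as a set \<open>S = insert i R\<close> with
  \<open>S \<inter> J = {i}\<close>, an event of known probability for each
  \<open>i \<in> S\<close>. The weight \<open>u\<close> serves both the plain energy and its noisy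
  version.\<close>

lemma random_weight_restricted_energy:
  assumes "finite N"
  shows "(\<Sum>J\<in>Pow N. random_weight N \<delta> J * (\<Sum>i\<in>J. \<Sum>R\<in>Pow N. (restricted_coeff N f J i R)\<^sup>2 * u (card R)))
    = (\<Sum>S\<in>Pow N. (fourier N f S)\<^sup>2 * u (card S - 1) * (real (card S) * (\<delta> * (1 - \<delta>) ^ (card S - 1))))"
proof -
  have fin: "finite S" if "S \<subseteq> N" for S
    using that assms by (rule finite_subset)
  have "(\<Sum>i\<in>J. \<Sum>R\<in>Pow N. (restricted_coeff N f J i R)\<^sup>2 * u (card R))
      = (\<Sum>S\<in>Pow N. \<Sum>i\<in>S. (fourier N f S)\<^sup>2 * u (card S - 1) * of_bool (S \<inter> J = {i}))"
    if J: "J \<subseteq> N" for J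
  proof -
    have card_minus: "card (insert i R) - Suc 0 = card R" if "i \<in> J" "R \<subseteq> N - J" for i R
      using that fin[of R] by (subst card_insert_disjoint) auto
    have "(\<Sum>R\<in>Pow N. (restricted_coeff N f J i R)\<^sup>2 * u (card R))
        = (\<Sum>R\<in>Pow (N - J). (fourier N f (insert i R))\<^sup>2 * u (card R))" for i
      by (rule sum.mono_neutral_cong_right) (use assms in \<open>auto simp: restricted_coeff_def\<close>)
    then have "(\<Sum>i\<in>J. \<Sum>R\<in>Pow N. (restricted_coeff N f J i R)\<^sup>2 * u (card R))
        = (\<Sum>(i, R)\<in>(SIGMA i:J. Pow (N - J)). (fourier N f (insert i R))\<^sup>2 * u (card R))"
      using fin[OF J] assms by (simp add: sum.Sigma)
    also have "\<dots> = (\<Sum>(S, i)\<in>(SIGMA S:Pow N. {i\<in>S. S \<inter> J = {i}}). (fourier N f S)\<^sup>2 * u (card S - 1))"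
      by (rule sum.reindex_bij_witness[where j = "\<lambda>(i, R). (insert i R, i)" and i = "\<lambda>(S, i). (i, S - {i})"])
        (use J in \<open>auto simp: card_minus\<close>)
    also have "\<dots> = (\<Sum>S\<in>Pow N. \<Sum>i\<in>{i\<in>S. S \<inter> J = {i}}. (fourier N f S)\<^sup>2 * u (card S - 1))"
      using assms by (subst sum.Sigma) (auto simp: fin)
    also have "\<dots> = (\<Sum>S\<in>Pow N. \<Sum>i\<in>S. (fourier N f S)\<^sup>2 * u (card S - 1) * of_bool (S \<inter> J = {i}))"
      by (intro sum.cong refl sum.mono_neutral_cong_left) (auto simp: fin)
    finally show ?thesis .
  qed
  then have "(\<Sum>J\<in>Pow N. random_weight N \<delta> J * (\<Sum>i\<in>J. \<Sum>R\<in>Pow N. (restricted_coeff N f J i R)\<^sup>2 * u (card R)))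
      = (\<Sum>J\<in>Pow N. \<Sum>S\<in>Pow N. \<Sum>i\<in>S.
          (fourier N f S)\<^sup>2 * u (card S - 1) * (random_weight N \<delta> J * of_bool (S \<inter> J = {i})))"
    by (simp add: sum_distrib_left mult_ac)
  also have "\<dots> = (\<Sum>S\<in>Pow N. \<Sum>i\<in>S. \<Sum>J\<in>Pow N.
          (fourier N f S)\<^sup>2 * u (card S - 1) * (random_weight N \<delta> J * of_bool (S \<inter> J = {i})))"
    by (subst sum.swap) (intro sum.cong refl sum.swap)
  also have "\<dots> = (\<Sum>S\<in>Pow N. \<Sum>i\<in>S.
          (fourier N f S)\<^sup>2 * u (card S - 1) * (\<delta> * (1 - \<delta>) ^ (card S - 1)))"
    by (intro sum.cong refl, subst sum_distrib_left[symmetric],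
        subst sum_random_weight_singleton) (use assms in auto)
  finally show ?thesis
    by (simp add: mult_ac)
qed

text \<open>Concavity of the square root, in the form of Cauchy-Schwarz: the mean of
  \<open>card (A \<inter> J)\<close> is \<open>\<delta> * card A\<close>.\<close>

lemma random_weight_sqrt_card_le:
  assumes "finite N" "A \<subseteq> N" "0 \<le> \<delta>" "\<delta> \<le> 1"
  shows "(\<Sum>J\<in>Pow N. random_weight N \<delta> J * sqrt (real (card (A \<inter> J)))) \<le> sqrt \<delta> * sqrt (real (card A))"
proof -
  let ?w = "random_weight N \<delta>"
  have w: "0 \<le> ?w J" for J
    using assms by (simp add: random_weight_nonneg)
  have finA: "finite A"
    using assms finite_subset by blast
  have "(\<Sum>J\<in>Pow N. ?w J * sqrt (real (card (A \<inter> J))))\<^sup>2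
      = (\<Sum>J\<in>Pow N. sqrt (?w J) * (sqrt (?w J) * sqrt (real (card (A \<inter> J)))))\<^sup>2"
    by (simp add: w mult.assoc[symmetric])
  also have "\<dots> \<le> (\<Sum>J\<in>Pow N. (sqrt (?w J))\<^sup>2) * (\<Sum>J\<in>Pow N. (sqrt (?w J) * sqrt (real (card (A \<inter> J))))\<^sup>2)"
    by (rule Cauchy_Schwarz_ineq_sum)
  also have "\<dots> = (\<Sum>J\<in>Pow N. ?w J * real (card (A \<inter> J)))"
    using assms(1) by (simp add: w power_mult_distrib sum_random_weight)
  also have "\<dots> = (\<Sum>J\<in>Pow N. \<Sum>i\<in>A. ?w J * of_bool ({i} \<inter> J = {i}))"
  proof -
    have "{i. {i} \<inter> J = {i}} = J" for J :: "'a set"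
      by auto
    then show ?thesis
      using finA by (simp add: sum_distrib_left[symmetric])
  qed
  also have "\<dots> = (\<Sum>i\<in>A. \<Sum>J\<in>Pow N. ?w J * of_bool ({i} \<inter> J = {i}))"
    by (rule sum.swap)
  also have "\<dots> = (\<Sum>i\<in>A. \<delta>)"
  proof (rule sum.cong)
    fix i assume "i \<in> A"
    then show "(\<Sum>J\<in>Pow N. ?w J * of_bool ({i} \<inter> J = {i})) = \<delta>"
      using sum_random_weight_singleton[OF assms(1), of "{i}" i] assms(2) by auto
  qed simp
  finally have "(\<Sum>J\<in>Pow N. ?w J * sqrt (real (card (A \<inter> J))))\<^sup>2 \<le> \<delta> * real (card A)"
    by (simp add: mult.commute)
  then show ?thesis
    by (metis real_le_rsqrt real_sqrt_mult)
qed

text \<open>For \<open>P\<close> saying that the edge in direction \<open>i\<close> counts towards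
  the red (or blue) sensitivity of \<open>X\<close>, this is one of the two summands of the
  Talagrand functional.\<close>

definition gradient_norm :: "'a set \<Rightarrow> ('a \<Rightarrow> 'a set \<Rightarrow> bool) \<Rightarrow> real" where
  "gradient_norm N P = avg N (\<lambda>X. sqrt (real (card {i\<in>N. P i X})))"

lemma gradient_norm_nonneg: "0 \<le> gradient_norm N P"
  unfolding gradient_norm_def by (intro avg_nonneg) simp

lemma random_weight_gradient_le:
  assumes "finite N" "0 \<le> \<delta>" "\<delta> \<le> 1"
  shows "(\<Sum>J\<in>Pow N. random_weight N \<delta> J * avg N (\<lambda>X. sqrt (real (card {i\<in>J. P i X}))))
    \<le> sqrt \<delta> * gradient_norm N P"
proof -
  have eq: "{i\<in>N. P i X} \<inter> J = {i\<in>J. P i X}" if "J \<subseteq> N" for J X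
    using that by auto
  have "(\<Sum>J\<in>Pow N. random_weight N \<delta> J * avg N (\<lambda>X. sqrt (real (card {i\<in>J. P i X}))))
      = avg N (\<lambda>X. \<Sum>J\<in>Pow N. random_weight N \<delta> J * sqrt (real (card ({i\<in>N. P i X} \<inter> J))))"
    by (simp add: avg_sum avg_cmult eq)
  also have "\<dots> \<le> avg N (\<lambda>X. sqrt \<delta> * sqrt (real (card {i\<in>N. P i X})))"
    by (intro avg_mono random_weight_sqrt_card_le assms) auto
  finally show ?thesis
    by (simp add: avg_cmult gradient_norm_def)
qed

text \<open>The inequality for a fixed \<open>J\<close> is averaged over random \<open>J\<close>. On
  the right only a \<open>\<delta>\<close> fraction of the directions survives, which gains the
  factor \<open>sqrt \<delta>\<close>.\<close>

lemma random_restriction_bound: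
  assumes "finite N" "\<And>X. X \<subseteq> N \<Longrightarrow> \<bar>f X\<bar> \<le> 1"
    and "\<And>X i. X \<subseteq> N \<Longrightarrow> i \<in> N \<Longrightarrow>
      of_bool (red i X) - of_bool (red i (sym_diff X {i})) - of_bool (blue i X) + of_bool (blue i (sym_diff X {i}))
        = f X - f (sym_diff X {i})"
    and \<delta>: "0 \<le> \<delta>" "\<delta> \<le> 1"
  shows "(\<Sum>S\<in>Pow N. (fourier N f S)\<^sup>2 * (real (card S) * (\<delta> * (1 - \<delta>) ^ (card S - 1))))
    \<le> sqrt \<delta> * (gradient_norm N red + gradient_norm N blue)"
proof -
  let ?w = "random_weight N \<delta>"
  have "(\<Sum>S\<in>Pow N. (fourier N f S)\<^sup>2 * (real (card S) * (\<delta> * (1 - \<delta>) ^ (card S - 1))))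
      = (\<Sum>J\<in>Pow N. ?w J * (\<Sum>i\<in>J. \<Sum>R\<in>Pow N. (restricted_coeff N f J i R)\<^sup>2))"
    using random_weight_restricted_energy[OF assms(1), of \<delta> f "\<lambda>_. 1"] by simp
  also have "\<dots> \<le> (\<Sum>J\<in>Pow N. ?w J * (avg N (\<lambda>X. sqrt (real (card {i\<in>J. red i X})))
      + avg N (\<lambda>X. sqrt (real (card {i\<in>J. blue i X})))))"
    by (intro sum_mono mult_left_mono coloured_gradient_restriction random_weight_nonneg assms) auto
  also have "\<dots> = (\<Sum>J\<in>Pow N. ?w J * avg N (\<lambda>X. sqrt (real (card {i\<in>J. red i X}))))
      + (\<Sum>J\<in>Pow N. ?w J * avg N (\<lambda>X. sqrt (real (card {i\<in>J. blue i X}))))"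
    by (simp add: distrib_left sum.distrib)
  also have "\<dots> \<le> sqrt \<delta> * (gradient_norm N red + gradient_norm N blue)"
    using random_weight_gradient_le[OF assms(1) \<delta>, of red] random_weight_gradient_le[OF assms(1) \<delta>, of blue]
    by (simp add: distrib_left)
  finally show ?thesis .
qed

text \<open>Dividing the previous bound by \<open>\<delta>\<close> and integrating it over \<open>\<delta>\<close>: the left-hand side becomes the
  derivative of \<open>1 - (1 - \<delta>) ^ card S\<close> and the right-hand side that of \<open>2 * sqrt \<delta>\<close>.\<close>

lemma noise_sensitivity_bound:
  assumes "finite N" "\<And>X. X \<subseteq> N \<Longrightarrow> \<bar>f X\<bar> \<le> 1"
    and "\<And>X i. X \<subseteq> N \<Longrightarrow> i \<in> N \<Longrightarrow>
      of_bool (red i X) - of_bool (red i (sym_diff X {i})) - of_bool (blue i X) + of_bool (blue i (sym_diff X {i}))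
        = f X - f (sym_diff X {i})"
    and "0 \<le> \<delta>" "\<delta> \<le> 1"
  shows "(\<Sum>S\<in>Pow N. (fourier N f S)\<^sup>2 * (1 - (1 - \<delta>) ^ card S))
    \<le> 2 * sqrt \<delta> * (gradient_norm N red + gradient_norm N blue)"
proof -
  define T where "T = gradient_norm N red + gradient_norm N blue"
  define \<Phi> where "\<Phi> x = 2 * sqrt x * T - (\<Sum>S\<in>Pow N. (fourier N f S)\<^sup>2 * (1 - (1 - x) ^ card S))" for x
  have "\<Phi> 0 \<le> \<Phi> \<delta>"
  \<comment> \<open>The derivative is taken on the open interval because the square root is not
    differentiable at 0; continuity covers the endpoints.\<close>
  proof (rule DERIV_nonneg_imp_increasing_open[where f = \<Phi>])
    fix x assume x: "0 < x" "x < \<delta>"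
    define D where "D = (\<Sum>S\<in>Pow N. (fourier N f S)\<^sup>2 * (real (card S) * (1 - x) ^ (card S - 1)))"
    have "((\<lambda>x. 2 * sqrt x * T) has_real_derivative (2 * (inverse (sqrt x) / 2) * T)) (at x)"
      using x by (intro DERIV_cmult_right DERIV_cmult DERIV_real_sqrt)
    moreover have "((\<lambda>x. (fourier N f S)\<^sup>2 * (1 - (1 - x) ^ card S)) has_real_derivative
        (fourier N f S)\<^sup>2 * (real (card S) * (1 - x) ^ (card S - 1))) (at x)" for S
      by (rule derivative_eq_intros refl | simp)+
    ultimately have "(\<Phi> has_real_derivative (2 * (inverse (sqrt x) / 2) * T - D)) (at x)"
      unfolding \<Phi>_def D_def by (intro DERIV_diff DERIV_sum)
    moreover have "2 * (inverse (sqrt x) / 2) * T - D = T / sqrt x - D"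
      by (simp add: field_simps)
    ultimately have "(\<Phi> has_real_derivative (T / sqrt x - D)) (at x)"
      by simp
    moreover have "x * D \<le> sqrt x * T"
      using random_restriction_bound[OF assms(1-3), of x] x assms
      by (simp add: D_def T_def sum_distrib_left mult_ac)
    then have "sqrt x * (sqrt x * D) \<le> sqrt x * T"
      using x by (simp add: mult.assoc[symmetric])
    then have "D \<le> T / sqrt x"
      using x by (simp add: pos_le_divide_eq mult.commute)
    ultimately show "\<exists>y. (\<Phi> has_real_derivative y) (at x) \<and> 0 \<le> y"
      by force
  next
    show "continuous_on {0..\<delta>} \<Phi>"
      unfolding \<Phi>_def by (intro continuous_intros)
  qed (use assms in simp)
  then show ?thesis
    by (simp add: \<Phi>_def T_def)
qed

section \<open>Noise stability bounds\<close>

text \<open>Noise 1/3 is noise \<open>1 / sqrt 3\<close> applied twice. One application is spent on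
  hypercontractivity, the other stays in the coefficients, so that the right-hand side is a squared
  noise stability.\<close>

lemma noise_fourth_moment:
  assumes "finite N"
  shows "avg N (\<lambda>X. (synth N (\<lambda>S. (1 / 3) ^ card S * c S) X) ^ 4) \<le> (\<Sum>S\<in>Pow N. (1 / 3) ^ card S * (c S)\<^sup>2)\<^sup>2"
proof -
  have r: "(1 / sqrt 3) ^ k * (1 / sqrt 3) ^ k = (1 / 3 :: real) ^ k" for k
    by (simp only: power_mult_distrib[symmetric]) simp
  have "(1 / sqrt 3) ^ k * ((1 / sqrt 3) ^ k * y) = (1 / 3) ^ k * y" for k y
    by (simp only: r mult.assoc[symmetric])
  moreover have "((1 / sqrt 3) ^ k * y)\<^sup>2 = (1 / 3) ^ k * y\<^sup>2" for k y
    by (simp only: power_mult_distrib power2_eq_square[of "(1 / sqrt 3) ^ k"] r)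
  ultimately show ?thesis
    using bonami[OF assms, of "\<lambda>S. (1 / sqrt 3) ^ card S * c S"] by (simp only:)
qed

lemma avg_synth_noise:
  assumes "finite N"
  shows "avg N (\<lambda>X. synth N c X * synth N (\<lambda>S. (1 / 3) ^ card S * c S) X) = (\<Sum>S\<in>Pow N. (1 / 3) ^ card S * (c S)\<^sup>2)"
  using avg_synth_mult[OF assms, of c "\<lambda>S. (1 / 3) ^ card S * c S"]
  by (simp add: power2_eq_square mult_ac)

definition cvar :: "'a set \<Rightarrow> ('a set \<Rightarrow> real) \<Rightarrow> real" where
  "cvar N f = avg N (\<lambda>X. (f X)\<^sup>2) - (avg N f)\<^sup>2"

lemma fourier_empty: "fourier N f {} = avg N f"
  by (simp add: fourier_def)

lemma sum_Pow_remove_empty: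
  fixes h :: "'a set \<Rightarrow> real"
  assumes "finite N"
  shows "(\<Sum>S\<in>Pow N. h S) = h {} + (\<Sum>S\<in>Pow N - {{}}. h S)"
  using assms by (subst sum.remove[of _ "{}"]) auto

lemma cvar_eq_sum:
  assumes "finite N"
  shows "cvar N f = (\<Sum>S\<in>Pow N - {{}}. (fourier N f S)\<^sup>2)"
  using parseval[OF assms, of f] sum_Pow_remove_empty[OF assms, of "\<lambda>S. (fourier N f S)\<^sup>2"]
  by (simp add: cvar_def fourier_empty)

lemma cvar_nonneg: "finite N \<Longrightarrow> 0 \<le> cvar N f"
  by (simp add: cvar_eq_sum sum_nonneg)

text \<open>The noise stability of the part of \<open>f\<close> with mean 0. A small value forces
  the Fourier weight to high levels.\<close>

definition noise_weight :: "'a set \<Rightarrow> ('a set \<Rightarrow> real) \<Rightarrow> real \<Rightarrow> real" where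
  "noise_weight N f q = (\<Sum>S\<in>Pow N - {{}}. q ^ card S * (fourier N f S)\<^sup>2)"

text \<open>Write \<open>W\<close> as the correlation of \<open>F = f - p\<close> with its noisy
  version \<open>h\<close>. Two applications of Cauchy-Schwarz and the fourth moment of
  \<open>h\<close> bound \<open>W\<^sup>2\<close> by \<open>2 * V * (sqrt V * W)\<close>. Being
  Boolean enters through the small mean \<open>2 * V\<close> of
  \<open>\<bar>F\<bar>\<close>.\<close>

lemma noise_weight_small_variance:
  assumes "finite N" and f: "\<And>X. X \<subseteq> N \<Longrightarrow> f X = 0 \<or> f X = 1"
  shows "noise_weight N f (1 / 3) \<le> 2 * cvar N f * sqrt (cvar N f)"
proof -
  define p where "p = avg N f"
  define V where "V = cvar N f"
  define W where "W = noise_weight N f (1 / 3)"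
  define c where "c S = (if S = {} then 0 else fourier N f S)" for S
  define F where "F X = f X - p" for X
  define h where "h = synth N (\<lambda>S. (1 / 3) ^ card S * c S)"
  have f': "0 \<le> f X" "f X \<le> 1" "(f X)\<^sup>2 = f X" if "X \<subseteq> N" for X
    using f[OF that] by auto
  have "avg N (\<lambda>X. (f X)\<^sup>2) = p"
    unfolding p_def using f' by (intro avg_cong)
  then have V: "V = p - p\<^sup>2"
    by (simp add: V_def cvar_def p_def)
  have V0: "V \<ge> 0"
    using cvar_nonneg[OF assms(1)] by (simp add: V_def)
  have p: "0 \<le> p" "p \<le> 1"
  proof -
    show "0 \<le> p"
      unfolding p_def using f' by (intro avg_nonneg)
    have "p \<le> avg N (\<lambda>_. 1)"
      unfolding p_def using f' by (intro avg_mono)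
    then show "p \<le> 1"
      using assms(1) by (simp add: avg_const)
  qed
  have avgF: "avg N (\<lambda>X. \<bar>F X\<bar>) = 2 * V"
  proof -
    \<comment> \<open>On the two values 0 and 1 of \<open>f\<close>, absolute value and square agree
      with affine functions of \<open>f\<close>, whose means are known.\<close>
    have "\<bar>F X\<bar> = (1 - 2 * p) * f X + p" if "X \<subseteq> N" for X
      using f[OF that] p by (auto simp: F_def)
    then have "avg N (\<lambda>X. \<bar>F X\<bar>) = avg N (\<lambda>X. (1 - 2 * p) * f X + p)"
      by (intro avg_cong)
    also have "\<dots> = (1 - 2 * p) * p + p"
      using assms(1) by (simp add: avg_add avg_cmult avg_const p_def[symmetric])
    finally show ?thesis
      by (simp add: V power2_eq_square algebra_simps)
  qed
  have avgF2: "avg N (\<lambda>X. (F X)\<^sup>2) = V"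
  proof -
    have "(F X)\<^sup>2 = (1 - 2 * p) * f X + p\<^sup>2" if "X \<subseteq> N" for X
      using f[OF that] by (auto simp: F_def power2_diff)
    then have "avg N (\<lambda>X. (F X)\<^sup>2) = avg N (\<lambda>X. (1 - 2 * p) * f X + p\<^sup>2)"
      by (intro avg_cong)
    also have "\<dots> = (1 - 2 * p) * p + p\<^sup>2"
      using assms(1) by (simp add: avg_add avg_cmult avg_const p_def[symmetric])
    finally show ?thesis
      by (simp add: V power2_eq_square algebra_simps)
  qed
  have F: "F X = synth N c X" if "X \<subseteq> N" for X
    using synth_fourier[OF assms(1) that, of f]
    by (simp add: F_def synth_def sum_Pow_remove_empty[OF assms(1)] c_def fourier_empty p_def)
  have Wc: "(\<Sum>S\<in>Pow N. (1 / 3) ^ card S * (c S)\<^sup>2) = W"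
    by (simp add: W_def noise_weight_def sum_Pow_remove_empty[OF assms(1)] c_def)
  have W0: "W \<ge> 0"
    by (auto simp: W_def noise_weight_def intro: sum_nonneg)
  have h4: "avg N (\<lambda>X. h X ^ 4) \<le> W\<^sup>2"
    using noise_fourth_moment[OF assms(1), of c] by (simp add: h_def Wc)
  have Wavg: "W = avg N (\<lambda>X. F X * h X)"
    using avg_synth_noise[OF assms(1), of c] F by (simp add: h_def Wc cong: avg_cong)
  have "W\<^sup>2 \<le> (avg N (\<lambda>X. sqrt \<bar>F X\<bar> * (sqrt \<bar>F X\<bar> * \<bar>h X\<bar>)))\<^sup>2"
  proof (rule power_mono)
    have "W \<le> avg N (\<lambda>X. \<bar>F X * h X\<bar>)"
      unfolding Wavg by (intro avg_mono) simp
    then show "W \<le> avg N (\<lambda>X. sqrt \<bar>F X\<bar> * (sqrt \<bar>F X\<bar> * \<bar>h X\<bar>))"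
      by (simp add: abs_mult mult.assoc[symmetric])
  qed (rule W0)
  also have "\<dots> \<le> avg N (\<lambda>X. \<bar>F X\<bar>) * avg N (\<lambda>X. \<bar>F X\<bar> * (h X)\<^sup>2)"
    using avg_Cauchy_Schwarz[of N "\<lambda>X. sqrt \<bar>F X\<bar>" "\<lambda>X. sqrt \<bar>F X\<bar> * \<bar>h X\<bar>"]
    by (simp add: power_mult_distrib)
  also have "\<dots> \<le> 2 * V * (sqrt V * W)"
    unfolding avgF
  proof (intro mult_left_mono)
    have "(avg N (\<lambda>X. \<bar>F X\<bar> * (h X)\<^sup>2))\<^sup>2 \<le> V * avg N (\<lambda>X. h X ^ 4)"
      using avg_Cauchy_Schwarz[of N "\<lambda>X. \<bar>F X\<bar>" "\<lambda>X. (h X)\<^sup>2"] by (simp add: avgF2)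
    also have "\<dots> \<le> V * W\<^sup>2"
      using h4 V0 by (rule mult_left_mono)
    finally have "avg N (\<lambda>X. \<bar>F X\<bar> * (h X)\<^sup>2) \<le> sqrt (V * W\<^sup>2)"
      by (rule real_le_rsqrt)
    then show "avg N (\<lambda>X. \<bar>F X\<bar> * (h X)\<^sup>2) \<le> sqrt V * W"
      using W0 by (simp add: real_sqrt_mult)
  qed (use V0 in simp)
  finally have "W * W \<le> (2 * V * sqrt V) * W"
    by (simp add: power2_eq_square mult_ac)
  then have "W \<le> 2 * V * sqrt V"
    using W0 V0 by (cases "W = 0") (auto simp: mult_le_cancel_right)
  then show ?thesis
    by (simp add: W_def V_def)
qed

text \<open>For \<open>f\<close> with values 0 and 1 the inner mean is the influence of
  \<open>i\<close>.\<close>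

definition sq_influence :: "'a set \<Rightarrow> ('a set \<Rightarrow> real) \<Rightarrow> real" where
  "sq_influence N f = (\<Sum>i\<in>N. (avg N (\<lambda>X. \<bar>f X - f (sym_diff X {i})\<bar>))\<^sup>2)"

text \<open>Each \<open>h i\<close> has controlled fourth moment, so it rarely exceeds \<open>t\<close> times its typical size \<open>sqrt (a i)\<close>.
  The part below that threshold is paid for by the influences, the part above it by the pointwise
  bound on the sum of the squares of the restricted Fourier coefficients; the split is done
  smoothly by the arithmetic-geometric mean inequality.\<close>

lemma restricted_noise_weight_le:
  assumes "finite N" "J \<subseteq> N" and f: "\<And>X. X \<subseteq> N \<Longrightarrow> \<bar>f X\<bar> \<le> 1"
    and M: "sq_influence N f > 0"
  shows "(\<Sum>i\<in>J. \<Sum>R\<in>Pow N. (restricted_coeff N f J i R)\<^sup>2 * (1 / 3) ^ card R) \<le> 4 * sqrt (sq_influence N f)"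
proof -
  define M where "M = sq_influence N f"
  have finJ: "finite J"
    using assms finite_subset by blast
  define c where "c = restricted_coeff N f J"
  define g where "g = restricted_fourier f J"
  define h where "h i = synth N (\<lambda>S. (1 / 3) ^ card S * c i S)" for i
  define a where "a i = (\<Sum>R\<in>Pow N. (1 / 3) ^ card R * (c i R)\<^sup>2)" for i
  \<comment> \<open>Discarding the vanishing \<open>a i\<close> permits division by
    \<open>sqrt (a i)\<close> and does not change the sum.\<close>
  define I where "I = {i\<in>J. a i > 0}"
  define A where "A = (\<Sum>i\<in>I. a i)"
  define infl where "infl i = avg N (\<lambda>X. \<bar>f X - f (sym_diff X {i})\<bar>)" for i
  have a0: "a i \<ge> 0" for i
    by (auto simp: a_def intro: sum_nonneg)
  have A0: "A \<ge> 0"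
    by (auto simp: A_def a0 intro: sum_nonneg)
  have IJ: "I \<subseteq> J" "finite I" "\<And>i. i \<in> I \<Longrightarrow> a i > 0"
    using finJ by (auto simp: I_def)
  have AJ: "(\<Sum>i\<in>J. a i) = A"
    unfolding A_def I_def by (rule sum.mono_neutral_right) (use finJ a0 in \<open>auto simp: le_less\<close>)
  have g: "avg N (\<lambda>X. g i X * h i X) = a i" if "i \<in> I" for i
  proof -
    have "g i X = synth N (c i) X" if "X \<subseteq> N" for X
      using restricted_fourier_eq_synth[OF assms(1,2) _ that] \<open>i \<in> I\<close> IJ(1) by (auto simp: g_def c_def)
    then show ?thesis
      using avg_synth_noise[OF assms(1), of "c i"] by (simp add: h_def a_def cong: avg_cong)
  qed
  have h4: "avg N (\<lambda>X. h i X ^ 4) \<le> (a i)\<^sup>2" for i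
    using noise_fourth_moment[OF assms(1), of "c i"] by (simp add: h_def a_def)
  have g1: "(\<Sum>i\<in>I. (g i X)\<^sup>2) \<le> 1" if "X \<subseteq> N" for X
  proof -
    have "(\<Sum>i\<in>I. (g i X)\<^sup>2) \<le> (\<Sum>i\<in>J. (g i X)\<^sup>2)"
      using finJ IJ by (intro sum_mono2) auto
    also have "\<dots> \<le> 1"
      unfolding g_def by (rule sum_restricted_fourier_le_1[OF finJ f]) (use that assms in blast)
    finally show ?thesis .
  qed
  have low: "(\<Sum>i\<in>I. sqrt (a i) * avg N (\<lambda>X. \<bar>g i X\<bar>)) \<le> sqrt A * sqrt M"
  proof -
    have "(\<Sum>i\<in>I. sqrt (a i) * avg N (\<lambda>X. \<bar>g i X\<bar>)) \<le> (\<Sum>i\<in>I. \<bar>sqrt (a i)\<bar> * \<bar>infl i\<bar>)"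
    proof (intro sum_mono mult_mono)
      fix i assume "i \<in> I"
      then have "avg N (\<lambda>X. \<bar>g i X\<bar>) \<le> infl i"
        unfolding g_def infl_def using IJ assms by (intro avg_abs_restricted_fourier_le) auto
      then show "avg N (\<lambda>X. \<bar>g i X\<bar>) \<le> \<bar>infl i\<bar>"
        by linarith
    qed (auto intro: avg_nonneg)
    also have "\<dots> \<le> L2_set (\<lambda>i. sqrt (a i)) I * L2_set infl I"
      by (rule L2_set_mult_ineq)
    also have "L2_set (\<lambda>i. sqrt (a i)) I = sqrt A"
      by (simp add: L2_set_def A_def a0)
    also have "L2_set infl I \<le> sqrt M"
      unfolding L2_set_def M_def sq_influence_def infl_def
      by (intro real_sqrt_le_mono sum_mono2) (use assms IJ in auto)
    finally show ?thesis
      using A0 by (simp add: mult_left_mono)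
  qed
  have high: "avg N (\<lambda>X. \<Sum>i\<in>I. (h i X)\<^sup>2 / sqrt (a i) * \<bar>g i X\<bar>) \<le> sqrt A"
  proof -
    define y where "y X = L2_set (\<lambda>i. (h i X)\<^sup>2 / sqrt (a i)) I" for X
    have "avg N (\<lambda>X. \<Sum>i\<in>I. (h i X)\<^sup>2 / sqrt (a i) * \<bar>g i X\<bar>) \<le> avg N y"
    proof (rule avg_mono)
      fix X assume "X \<subseteq> N"
      have "(\<Sum>i\<in>I. (h i X)\<^sup>2 / sqrt (a i) * \<bar>g i X\<bar>) = (\<Sum>i\<in>I. \<bar>(h i X)\<^sup>2 / sqrt (a i)\<bar> * \<bar>g i X\<bar>)"
        using a0 by (simp add: abs_divide)
      also have "\<dots> \<le> y X * L2_set (\<lambda>i. g i X) I"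
        unfolding y_def by (rule L2_set_mult_ineq)
      also have "\<dots> \<le> y X * 1"
        using g1[OF \<open>X \<subseteq> N\<close>] by (intro mult_left_mono) (auto simp: L2_set_def y_def intro: sum_nonneg)
      finally show "(\<Sum>i\<in>I. (h i X)\<^sup>2 / sqrt (a i) * \<bar>g i X\<bar>) \<le> y X"
        by simp
    qed
    also have "\<dots> \<le> sqrt (avg N (\<lambda>X. (y X)\<^sup>2))"
      by (rule avg_le_sqrt[OF assms(1)])
    also have "avg N (\<lambda>X. (y X)\<^sup>2) = (\<Sum>i\<in>I. 1 / a i * avg N (\<lambda>X. h i X ^ 4))"
      unfolding avg_cmult[symmetric] avg_sum[symmetric]
      by (rule avg_cong) (simp add: y_def L2_set_def sum_nonneg power_divide a0)
    also have "\<dots> \<le> (\<Sum>i\<in>I. 1 / a i * (a i)\<^sup>2)"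
      by (intro sum_mono mult_left_mono h4) (use a0 in auto)
    also have "\<dots> = A"
      unfolding A_def by (rule sum.cong) (auto simp: power2_eq_square)
    finally show ?thesis
      by simp
  qed
  have bound: "A \<le> sqrt A * (t * sqrt M + 1 / t)" if "t > 0" for t
  proof -
    have "A = avg N (\<lambda>X. \<Sum>i\<in>I. g i X * h i X)"
      by (simp add: A_def avg_sum g)
    also have "\<dots> \<le> avg N (\<lambda>X. t * (\<Sum>i\<in>I. sqrt (a i) * \<bar>g i X\<bar>) + 1 / t * (\<Sum>i\<in>I. (h i X)\<^sup>2 / sqrt (a i) * \<bar>g i X\<bar>))"
      unfolding sum_distrib_left sum.distrib[symmetric]
    proof (intro avg_mono sum_mono)
      fix X i assume "i \<in> I"
      \<comment> \<open>The threshold: \<open>t\<close> times the typical size of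
        \<open>h i\<close>. The bound \<open>\<bar>h\<bar> \<le> s + h\<^sup>2 / s\<close> replaces
        a case distinction at \<open>s\<close>.\<close>
      define s where "s = t * sqrt (a i)"
      have s: "s > 0"
        using IJ(3)[OF \<open>i \<in> I\<close>] \<open>t > 0\<close> by (simp add: s_def)
      have "0 \<le> \<bar>h i X\<bar> * s" "2 * \<bar>h i X\<bar> * s \<le> \<bar>h i X\<bar>\<^sup>2 + s\<^sup>2"
        using s sum_squares_bound[of "\<bar>h i X\<bar>" s] by simp_all
      then have "\<bar>h i X\<bar> * s \<le> s\<^sup>2 + (h i X)\<^sup>2"
        by simp
      then have "\<bar>h i X\<bar> \<le> s + (h i X)\<^sup>2 / s"
        using s by (simp add: field_simps power2_eq_square)
      then have "\<bar>g i X\<bar> * \<bar>h i X\<bar> \<le> \<bar>g i X\<bar> * (s + (h i X)\<^sup>2 / s)"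
        by (rule mult_left_mono) simp
      moreover have "g i X * h i X \<le> \<bar>g i X\<bar> * \<bar>h i X\<bar>"
        by (metis abs_ge_self abs_mult)
      ultimately show "g i X * h i X
          \<le> t * (sqrt (a i) * \<bar>g i X\<bar>) + 1 / t * ((h i X)\<^sup>2 / sqrt (a i) * \<bar>g i X\<bar>)"
        by (simp add: s_def algebra_simps)
    qed
    also have "\<dots> \<le> t * (sqrt A * sqrt M) + 1 / t * sqrt A"
    proof -
      have "avg N (\<lambda>X. \<Sum>i\<in>I. sqrt (a i) * \<bar>g i X\<bar>) = (\<Sum>i\<in>I. sqrt (a i) * avg N (\<lambda>X. \<bar>g i X\<bar>))"
        by (simp add: avg_sum avg_cmult)
      then show ?thesis
        unfolding avg_add avg_cmult using low high \<open>t > 0\<close>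
        by (intro add_mono mult_left_mono) auto
    qed
    finally show ?thesis
      by (simp add: algebra_simps)
  qed
  have "sqrt A \<le> 2 * sqrt (sqrt M)"
  proof (cases "A = 0")
    case False
    \<comment> \<open>The choice \<open>t = 1 / r\<close> balances the bound:
      \<open>t * sqrt M\<close> and \<open>1 / t\<close> both equal \<open>r\<close>.\<close>
    define r where "r = sqrt (sqrt M)"
    have r: "r > 0" "sqrt M = r * r"
      using M by (simp_all add: r_def M_def)
    have "sqrt A * sqrt A \<le> sqrt A * (2 * r)"
      using bound[of "1 / r"] r A0 by simp
    then have "sqrt A \<le> 2 * r"
      by (rule mult_left_le_imp_le) (use False A0 in simp)
    then show ?thesis
      by (simp add: r_def)
  qed (simp add: M_def sq_influence_def sum_nonneg)
  then have "(sqrt A)\<^sup>2 \<le> (2 * sqrt (sqrt M))\<^sup>2"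
    using A0 by (intro power_mono) auto
  then have "A \<le> 4 * sqrt M"
    using A0 M by (simp add: power_mult_distrib M_def)
  moreover have "(\<Sum>i\<in>J. \<Sum>R\<in>Pow N. (restricted_coeff N f J i R)\<^sup>2 * (1 / 3) ^ card R) = A"
    unfolding AJ[symmetric] a_def c_def by (simp add: mult.commute)
  ultimately show ?thesis
    by (simp add: M_def)
qed

text \<open>The bound for a fixed \<open>J\<close> is averaged with \<open>\<delta> = 1 / 2\<close>.
  Noise 1/3 on the fixed coordinates and the survival factor 1/2 combine to 1/6.\<close>

lemma noise_weight_small_influences:
  assumes "finite N" "\<And>X. X \<subseteq> N \<Longrightarrow> \<bar>f X\<bar> \<le> 1" "sq_influence N f > 0"
  shows "noise_weight N f (1 / 6) \<le> 2 * sqrt (sq_influence N f)"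
proof -
  let ?M = "sq_influence N f"
  \<comment> \<open>At level \<open>k + 1\<close> the right-hand factor is
    \<open>(1/3)^k * (k + 1) * (1/2)^(k + 1)\<close>, which is \<open>3 * (k + 1)\<close> times
    \<open>(1/6)^(k + 1)\<close>.\<close>
  have le_term: "3 * ((1 / 6) ^ card S * (fourier N f S)\<^sup>2)
      \<le> (fourier N f S)\<^sup>2 * (1 / 3) ^ (card S - 1) * (real (card S) * (1 / 2 * (1 / 2) ^ (card S - 1)))"
    if S: "S \<in> Pow N - {{}}" for S
  proof -
    have "finite S"
      using S assms(1) finite_subset by blast
    then obtain k where k: "card S = Suc k"
      using S by (metis DiffD2 card_eq_0_iff insertI1 not0_implies_Suc)
    define F y z where "F = (fourier N f S)\<^sup>2" and "y = (1 / 2 :: real) ^ k" and "z = (1 / 3 :: real) ^ k"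
    have "(1 / 6 :: real) ^ k = z * y"
      unfolding y_def z_def power_mult_distrib[symmetric] by simp
    then have six: "(1 / 6 :: real) ^ Suc k = z * y / 6"
      by simp
    have "F * z * (real (Suc k) * (1 / 2 * y)) - 3 * (z * y / 6 * F) = real k * (F * z * y) / 2"
      by (simp add: field_simps)
    also have "\<dots> \<ge> 0"
      by (simp add: F_def y_def z_def)
    finally show ?thesis
      unfolding k six by (simp only: diff_Suc_1 F_def y_def z_def)
  qed
  have "3 * noise_weight N f (1 / 6) = (\<Sum>S\<in>Pow N - {{}}. 3 * ((1 / 6) ^ card S * (fourier N f S)\<^sup>2))"
    by (simp add: noise_weight_def sum_distrib_left)
  also have "\<dots> \<le> (\<Sum>S\<in>Pow N - {{}}.
      (fourier N f S)\<^sup>2 * (1 / 3) ^ (card S - 1) * (real (card S) * (1 / 2 * (1 / 2) ^ (card S - 1))))"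
    by (rule sum_mono) (rule le_term)
  \<comment> \<open>The empty set may be added because the factor \<open>card S\<close> vanishes
    there, whatever the truncated \<open>card S - 1\<close> is.\<close>
  also have "\<dots> = (\<Sum>S\<in>Pow N.
      (fourier N f S)\<^sup>2 * (1 / 3) ^ (card S - 1) * (real (card S) * (1 / 2 * (1 / 2) ^ (card S - 1))))"
    by (simp add: sum_Pow_remove_empty[OF assms(1)])
  also have "\<dots> = (\<Sum>J\<in>Pow N. random_weight N (1 / 2) J
      * (\<Sum>i\<in>J. \<Sum>R\<in>Pow N. (restricted_coeff N f J i R)\<^sup>2 * (1 / 3) ^ card R))"
    using random_weight_restricted_energy[OF assms(1), of "1 / 2" f "\<lambda>k. (1 / 3) ^ k"] by simp
  also have "\<dots> \<le> (\<Sum>J\<in>Pow N. random_weight N (1 / 2) J * (4 * sqrt ?M))"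
    by (intro sum_mono mult_left_mono restricted_noise_weight_le random_weight_nonneg assms) auto
  also have "\<dots> = 4 * sqrt ?M"
    using sum_random_weight[OF assms(1), of "1 / 2"] by (simp add: sum_distrib_right[symmetric])
  finally show ?thesis
    using assms(3) real_sqrt_gt_zero[of ?M] by linarith
qed

section \<open>From noise stability to the two lower bounds\<close>

text \<open>Up to level \<open>d\<close> the second term alone is at least 1; beyond it the
  left-hand side is below \<open>exp (- 1)\<close>. Summed against the Fourier weights, this charges
  the low levels to the noise weight.\<close>

lemma one_minus_power_le:
  fixes d q :: real
  assumes "d \<ge> 1" "0 < q" "q \<le> 1"
  shows "(1 - 1 / d) ^ k \<le> 1 / 2 + q ^ k / q powr d"
proof (cases "real k \<le> d")
  case True
  have "q powr d \<le> q powr real k"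
    using assms True by (intro powr_mono') auto
  then have "1 \<le> q ^ k / q powr d"
    using assms by (simp add: powr_realpow)
  moreover have "(1 - 1 / d) ^ k \<le> 1"
    using assms by (intro power_le_one) auto
  ultimately show ?thesis
    by linarith
next
  case False
  have "(1 - 1 / d) ^ k \<le> exp (- 1 / d) ^ k"
    using assms exp_ge_add_one_self[of "- 1 / d"] by (intro power_mono) auto
  also have "\<dots> = exp (- (real k / d))"
    by (simp add: exp_of_nat_mult[symmetric])
  also have "\<dots> \<le> exp (- 1)"
    using assms False by (simp add: field_simps)
  also have "\<dots> \<le> 1 / 2"
    using exp_ge_add_one_self[of 1] by (simp add: exp_minus inverse_eq_divide field_simps)
  finally show ?thesis
    using assms by (simp add: add_increasing2)
qed

text \<open>In the intended instance \<open>red i X\<close> says that the edge at \<open>X\<close>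
  in direction \<open>i\<close> is red, sensitive and has \<open>f X = 1\<close>;
  \<open>blue\<close> is the same with \<open>f X = 0\<close>. A sensitive edge then counts at
  exactly one endpoint, and \<open>colours\<close> records this with the sign of the
  difference.\<close>

locale coloured_boolean_function =
  fixes N :: "'a set" and f :: "'a set \<Rightarrow> real" and red blue :: "'a \<Rightarrow> 'a set \<Rightarrow> bool"
  assumes finite: "finite N"
    and boolean: "X \<subseteq> N \<Longrightarrow> f X = 0 \<or> f X = 1"
    and colours: "X \<subseteq> N \<Longrightarrow> i \<in> N \<Longrightarrow>
      of_bool (red i X) - of_bool (red i (sym_diff X {i})) - of_bool (blue i X) + of_bool (blue i (sym_diff X {i}))
        = f X - f (sym_diff X {i})"
begin

definition talagrand :: real where
  "talagrand = gradient_norm N red + gradient_norm N blue"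

lemma abs_le_1: "X \<subseteq> N \<Longrightarrow> \<bar>f X\<bar> \<le> 1"
  using boolean[of X] by auto

lemma sum_noise_sensitivity_le:
  assumes "0 \<le> \<delta>" "\<delta> \<le> 1"
  shows "(\<Sum>S\<in>Pow N - {{}}. (fourier N f S)\<^sup>2 * (1 - (1 - \<delta>) ^ card S)) \<le> 2 * sqrt \<delta> * talagrand"
  using noise_sensitivity_bound[OF finite abs_le_1 colours assms]
  by (simp add: talagrand_def sum_Pow_remove_empty[OF finite])

text \<open>The case \<open>\<delta> = 1\<close>, where every nonempty frequency counts fully. This
  bound settles all cases in which the logarithm is bounded.\<close>

lemma cvar_le_talagrand: "cvar N f / 2 \<le> talagrand"
proof -
  have "(fourier N f S)\<^sup>2 * (1 - (1 - 1) ^ card S) = (fourier N f S)\<^sup>2" if "S \<in> Pow N - {{}}" for S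
    using finite_subset[of S N] finite that by (simp add: power_0_left card_eq_0_iff)
  then have "(\<Sum>S\<in>Pow N - {{}}. (fourier N f S)\<^sup>2 * (1 - (1 - 1) ^ card S)) = cvar N f"
    unfolding cvar_eq_sum[OF finite] by (intro sum.cong refl)
  then show ?thesis
    using sum_noise_sensitivity_le[of 1] by simp
qed

text \<open>Take \<open>\<delta> = 1 / d\<close>. Of the variance \<open>V\<close>, one half is lost
  to the constant in \<open>one_minus_power_le\<close> and one quarter to the noise weight; the
  remaining \<open>V / 4\<close> is at most \<open>2 * talagrand / sqrt d\<close>.\<close>

lemma cvar_sqrt_le_talagrand:
  assumes "d \<ge> 1" "0 < q" "q \<le> 1"
    and noise: "noise_weight N f q \<le> q powr d * cvar N f / 4"
  shows "cvar N f * sqrt d / 8 \<le> talagrand"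
proof -
  have "cvar N f - (cvar N f / 2 + noise_weight N f q / q powr d)
      = (\<Sum>S\<in>Pow N - {{}}. (fourier N f S)\<^sup>2 * (1 - (1 / 2 + q ^ card S / q powr d)))"
    unfolding cvar_eq_sum[OF finite] noise_weight_def sum_divide_distrib
      sum.distrib[symmetric] sum_subtractf[symmetric]
    by (rule sum.cong) (auto simp: algebra_simps)
  also have "\<dots> \<le> (\<Sum>S\<in>Pow N - {{}}. (fourier N f S)\<^sup>2 * (1 - (1 - 1 / d) ^ card S))"
    by (intro sum_mono mult_left_mono diff_left_mono one_minus_power_le assms) simp
  also have "\<dots> \<le> 2 * sqrt (1 / d) * talagrand"
    by (rule sum_noise_sensitivity_le) (use assms in auto)
  also have "\<dots> = 2 * talagrand / sqrt d"
    by (simp add: real_sqrt_divide)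
  finally have "cvar N f / 2 - noise_weight N f q / q powr d \<le> 2 * talagrand / sqrt d"
    by simp
  moreover have "noise_weight N f q / q powr d \<le> cvar N f / 4"
    using noise assms by (simp add: pos_divide_le_eq mult.commute)
  ultimately have "cvar N f / 4 \<le> 2 * talagrand / sqrt d"
    by linarith
  then show ?thesis
    using assms by (simp add: pos_le_divide_eq)
qed

lemma talagrand_ge_variance: "cvar N f * sqrt (log 2 (1 / cvar N f)) / 24 \<le> talagrand"
proof -
  define V where "V = cvar N f"
  define L where "L = log 2 (1 / V)"
  have V0: "0 \<le> V"
    by (simp add: V_def cvar_nonneg[OF finite])
  have half: "V / 2 \<le> talagrand"
    using cvar_le_talagrand by (simp add: V_def)
  \<comment> \<open>Below 16, \<open>sqrt L\<close> is less than 4 and the bound without logarithm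
    suffices. From 16 on, \<open>d = L / 8\<close> is at least 1 and \<open>3 - L / 2\<close> is at
    most \<open>- L / 4\<close>.\<close>
  consider "V = 0" | "V > 0" "L < 16" | "V > 0" "L \<ge> 16"
    using V0 by linarith
  then have "V * sqrt L / 24 \<le> talagrand"
  proof cases
    case 1
    then show ?thesis
      using half by simp
  next
    case 2
    then have "sqrt L \<le> sqrt (4\<^sup>2)"
      by (intro real_sqrt_le_mono) simp
    then have "V * sqrt L \<le> V * 4"
      using V0 by (intro mult_left_mono) auto
    then show ?thesis
      using half V0 by linarith
  next
    case 3
    have V: "V = 2 powr (- L)"
      using 3 by (simp add: L_def log_divide powr_minus)
    have "8 * sqrt V = 2 powr (3 + - L / 2)"
      unfolding powr_add by (simp add: V powr_half_sqrt[symmetric] powr_powr)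
    also have "\<dots> \<le> 2 powr (- (2 * (L / 8)))"
      using 3 by (intro powr_mono) auto
    also have "\<dots> = (1 / 4) powr (L / 8)"
      using powr_powr[of 2 "-2" "L / 8"] by (simp add: powr_minus_divide)
    also have "\<dots> \<le> (1 / 3) powr (L / 8)"
      using 3 by (intro powr_mono2) auto
    finally have "8 * sqrt V * (V / 4) \<le> (1 / 3) powr (L / 8) * (V / 4)"
      using V0 by (intro mult_right_mono) auto
    moreover have "noise_weight N f (1 / 3) \<le> 2 * V * sqrt V"
      unfolding V_def by (rule noise_weight_small_variance[OF finite boolean])
    moreover have "8 * sqrt V * (V / 4) = 2 * V * sqrt V"
      by simp
    ultimately have "noise_weight N f (1 / 3) \<le> (1 / 3) powr (L / 8) * V / 4"
      by linarith
    then have "V * sqrt (L / 8) / 8 \<le> talagrand"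
      using 3 unfolding V_def by (intro cvar_sqrt_le_talagrand) auto
    moreover have "sqrt L / 3 \<le> sqrt (L / 8)"
      using 3 by (intro real_le_rsqrt) (simp add: power_divide)
    then have "V * (sqrt L / 3) \<le> V * sqrt (L / 8)"
      using V0 by (rule mult_left_mono)
    ultimately show ?thesis
      by simp
  qed
  then show ?thesis
    by (simp add: V_def L_def)
qed

text \<open>If \<open>V\<close> is at least the fourth root of \<open>M\<close>, the noise weight at
  1/6 is small enough for \<open>d = L / 24\<close>. Otherwise \<open>log 2 (1 / V)\<close> is at
  least \<open>L / 4\<close> and the variance bound applies. The two cases give the constants 1/80
  and 1/96, whence 1/100.\<close>

lemma talagrand_ge_influences:
  "cvar N f * sqrt (log 2 (1 + 1 / sq_influence N f)) / 100 \<le> talagrand"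
proof -
  define V where "V = cvar N f"
  define M where "M = sq_influence N f"
  define L where "L = log 2 (1 / M)"
  define L' where "L' = log 2 (1 + 1 / M)"
  have V0: "0 \<le> V"
    by (simp add: V_def cvar_nonneg[OF finite])
  have M0: "0 \<le> M"
    by (simp add: M_def sq_influence_def sum_nonneg)
  have half: "V / 2 \<le> talagrand"
    using cvar_le_talagrand by (simp add: V_def)
  \<comment> \<open>For \<open>M = 0\<close> the quotient \<open>1 / M\<close> is 0, so the
    logarithm vanishes.\<close>
  consider "M = 0" | "M > 0" "L < 32" | "M > 0" "L \<ge> 32"
    using M0 by linarith
  then have "V * sqrt L' / 100 \<le> talagrand"
  proof cases
    case 1
    then show ?thesis
      using half V0 by (simp add: L'_def)
  next
    case 2
    have "1 / M = 2 powr L"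
      using 2 by (simp add: L_def)
    also have "\<dots> < 2 powr 32"
      using 2 by (intro powr_less_mono) auto
    finally have "1 + 1 / M \<le> 2 powr 36"
      by simp
    then have "L' \<le> log 2 (2 powr 36 :: real)"
      unfolding L'_def using 2 by (intro log_le_cancel_iff[THEN iffD2]) (auto intro: add_pos_pos)
    also have "log 2 (2 powr 36 :: real) = (36 :: real)"
      by (rule log_powr_cancel) auto
    finally have "L' \<le> 6\<^sup>2"
      by simp
    then have "sqrt L' \<le> sqrt (6\<^sup>2)"
      by (intro real_sqrt_le_mono)
    then have "V * sqrt L' \<le> V * 6"
      using V0 by (intro mult_left_mono) auto
    then show ?thesis
      using half V0 by linarith
  next
    case 3
    have M: "M = 2 powr (- L)"
      using 3 by (simp add: L_def log_divide powr_minus)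
    have "1 \<le> 1 / M"
      using 3 unfolding M by (simp add: powr_minus_divide ge_one_powr_ge_zero)
    then have "L' \<le> log 2 (2 * (1 / M))"
      unfolding L'_def by (intro log_le_cancel_iff[THEN iffD2]) linarith+
    also have "\<dots> = 1 + L"
      using 3 by (simp add: L_def log_mult log_divide)
    also have "\<dots> \<le> 2\<^sup>2 * L"
      using 3 by simp
    finally have "sqrt L' \<le> sqrt (2\<^sup>2 * L)"
      by (rule real_sqrt_le_mono)
    then have L': "V * sqrt L' \<le> V * (2 * sqrt L)"
      using V0 by (intro mult_left_mono) (auto simp: real_sqrt_mult)
    show ?thesis
    proof (cases "V \<ge> 2 powr (- (L / 4))")
      case True
      have "8 * sqrt M = 2 powr (3 + - L / 2)"
        unfolding powr_add by (simp add: M powr_half_sqrt[symmetric] powr_powr)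
      also have "\<dots> \<le> 2 powr (- (3 * (L / 24)) + - (L / 4))"
        using 3 by (intro powr_mono) auto
      also have "\<dots> = (1 / 8) powr (L / 24) * 2 powr (- (L / 4))"
        unfolding powr_add using powr_powr[of 2 "-3" "L / 24"] by (simp add: powr_minus_divide)
      also have "\<dots> \<le> (1 / 6) powr (L / 24) * V"
        using 3 True by (intro mult_mono powr_mono2) auto
      finally have "8 * sqrt M \<le> (1 / 6) powr (L / 24) * V" .
      moreover have "noise_weight N f (1 / 6) \<le> 2 * sqrt M"
        unfolding M_def using 3(1) by (intro noise_weight_small_influences finite abs_le_1) (simp_all add: M_def)
      ultimately have "noise_weight N f (1 / 6) \<le> (1 / 6) powr (L / 24) * V / 4"
        by linarith
      then have "V * sqrt (L / 24) / 8 \<le> talagrand"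
        using 3 unfolding V_def by (intro cvar_sqrt_le_talagrand) auto
      moreover have "sqrt L / 5 \<le> sqrt (L / 24)"
        using 3 by (intro real_le_rsqrt) (simp add: power_divide)
      then have "V * (sqrt L / 5) \<le> V * sqrt (L / 24)"
        using V0 by (rule mult_left_mono)
      ultimately have "V * sqrt L / 40 \<le> talagrand"
        by simp
      moreover have "0 \<le> V * sqrt L"
        using V0 3 by simp
      ultimately show ?thesis
        using L' by simp
    next
      case False
      show ?thesis
      proof (cases "V = 0")
        case True
        then show ?thesis
          using half by simp
      next
        case False
        with V0 have "V > 0"
          by simp
        have "2 powr (L / 4) \<le> 1 / V"
          using \<open>\<not> V \<ge> 2 powr (- (L / 4))\<close> \<open>V > 0\<close> by (simp add: powr_minus field_simps)
        then have "L / 4 \<le> log 2 (1 / V)"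
          using \<open>V > 0\<close> by (subst le_log_iff) simp_all
        then have "sqrt (L / 2\<^sup>2) \<le> sqrt (log 2 (1 / V))"
          by (intro real_sqrt_le_mono) simp
        then have "V * (sqrt L / 2) \<le> V * sqrt (log 2 (1 / V))"
          using V0 by (intro mult_left_mono) (auto simp: real_sqrt_divide)
        moreover have "V * sqrt (log 2 (1 / V)) / 24 \<le> talagrand"
          using talagrand_ge_variance by (simp add: V_def)
        moreover have "0 \<le> V * sqrt L"
          using V0 3 by simp
        ultimately show ?thesis
          using L' by simp
      qed
    qed
  qed
  then show ?thesis
    by (simp add: V_def M_def L'_def)
qed

end

section \<open>Transfer to functions on bit vectors\<close>

definition cube_point :: "nat \<Rightarrow> nat set \<Rightarrow> nat \<Rightarrow> bool" where
  "cube_point n X = (\<lambda>i\<in>{..<n}. i \<in> X)"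

lemma bij_betw_cube_point: "bij_betw (cube_point n) (Pow {..<n}) (cube n)"
proof (rule bij_betw_byWitness[where f' = "\<lambda>x. {i. i < n \<and> x i}"])
  show "\<forall>x\<in>cube n. cube_point n {i. i < n \<and> x i} = x"
    by (auto simp: cube_point_def cube_def PiE_iff extensional_def fun_eq_iff)
qed (auto simp: cube_point_def cube_def)

lemma cube_point_in_cube: "X \<subseteq> {..<n} \<Longrightarrow> cube_point n X \<in> cube n"
  using bij_betw_cube_point by (auto simp: bij_betw_def)

lemma card_cube: "card (cube n) = 2 ^ n"
  using bij_betw_same_card[OF bij_betw_cube_point] by (simp add: card_Pow)

lemma flip_coord_cube_point:
  "i < n \<Longrightarrow> flip_coord i (cube_point n X) = cube_point n (sym_diff X {i})"
  by (auto simp: flip_coord_def cube_point_def fun_eq_iff)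

lemma cube_expectation_eq_avg: "cube_expectation n h = avg {..<n} (\<lambda>X. h (cube_point n X))"
  unfolding uniform_cube_def integral_pmf_of_set[OF cube_nonempty finite_cube] avg_def card_cube
  using sum.reindex_bij_betw[OF bij_betw_cube_point, of h] by simp

lemma influence_eq_avg:
  assumes "i < n"
  shows "influence n f i
    = avg {..<n} (\<lambda>X. \<bar>of_bool (f (cube_point n X)) - of_bool (f (cube_point n (sym_diff X {i})))\<bar>)"
proof -
  have "influence n f i = cube_expectation n (\<lambda>x. indicator {x. f x \<noteq> f (flip_coord i x)} x)"
    by (simp add: influence_def)
  also have "\<dots> = avg {..<n} (\<lambda>X. \<bar>of_bool (f (cube_point n X)) - of_bool (f (cube_point n (sym_diff X {i})))\<bar>)"
    unfolding cube_expectation_eq_avg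
    by (rule avg_cong) (use assms in \<open>auto simp: flip_coord_cube_point indicator_def\<close>)
  finally show ?thesis .
qed

lemma flip_coord_flip_coord [simp]: "flip_coord i (flip_coord i x) = x"
  by (auto simp: flip_coord_def)

lemma flip_coord_eq_iff [simp]: "flip_coord i x = flip_coord j x \<longleftrightarrow> i = j"
  by (auto simp: flip_coord_def fun_eq_iff split: if_splits)

text \<open>Edges are unordered pairs, so an edge containing \<open>x\<close> may be presented from
  its other endpoint; flipping back rewrites it as \<open>{x, flip_coord i x}\<close>. The direction
  \<open>i\<close> is determined by the edge, so directions can be counted instead.\<close>

lemma card_sensitive_edges_at:
  assumes "x \<in> cube n"
  shows "card {e \<in> sensitive_edges n f. x \<in> e \<and> col e = c}
    = card {i\<in>{..<n}. f x \<noteq> f (flip_coord i x) \<and> col {x, flip_coord i x} = c}"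
proof -
  let ?I = "{i\<in>{..<n}. f x \<noteq> f (flip_coord i x) \<and> col {x, flip_coord i x} = c}"
  have "{e \<in> sensitive_edges n f. x \<in> e \<and> col e = c} = (\<lambda>i. {x, flip_coord i x}) ` ?I"
  proof (intro equalityI subsetI)
    fix e assume e0: "e \<in> {e \<in> sensitive_edges n f. x \<in> e \<and> col e = c}"
    then have "e \<in> cube_edges n" "\<exists>u v. e = {u, v} \<and> f u \<noteq> f v"
      by (simp_all add: sensitive_edges_def)
    then obtain y i u v where e: "e = {y, flip_coord i y}" "i < n" "e = {u, v}" "f u \<noteq> f v"
      unfolding cube_edges_def by (elim exE conjE CollectE)
    have "x = y \<or> x = flip_coord i y"
      using e0 e(1) by simp
    then have ex: "e = {x, flip_coord i x}"
      unfolding e(1) by (elim disjE) (simp_all add: insert_commute)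
    then have "{u, v} = {x, flip_coord i x}"
      using e(3) by simp
    then have "f x \<noteq> f (flip_coord i x)"
      using e(4) unfolding doubleton_eq_iff by metis
    then show "e \<in> (\<lambda>i. {x, flip_coord i x}) ` ?I"
      using ex e(2) e0 by (intro image_eqI[of _ _ i]) simp_all
  next
    fix e assume "e \<in> (\<lambda>i. {x, flip_coord i x}) ` ?I"
    then show "e \<in> {e \<in> sensitive_edges n f. x \<in> e \<and> col e = c}"
      using assms unfolding sensitive_edges_def cube_edges_def by blast
  qed
  moreover have "inj_on (\<lambda>i. {x, flip_coord i x}) ?I"
    by (auto simp: inj_on_def doubleton_eq_iff)
  ultimately show ?thesis
    by (simp add: card_image)
qed

theorem mainTheorem3:
  shows "\<exists>c::real. c > 0 \<and>
    (\<forall>(n::nat) (f :: (nat \<Rightarrow> bool) \<Rightarrow> bool) (col :: coloring).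
       n \<ge> 1 \<longrightarrow> \<not> f constant_on cube n \<longrightarrow>
         talagrand_col n col f \<ge> c * cube_var n f * sqrt (log 2 (1 / cube_var n f)) \<and>
         talagrand_col n col f \<ge>
           c * cube_var n f * sqrt (log 2 (1 + 1 / (\<Sum>i<n. (influence n f i)\<^sup>2))))"
\<comment> \<open>The constants obtained are 1/24 and 1/100; the smaller one serves both
  bounds.\<close>
proof (intro exI[of _ "1 / 100"] conjI allI impI)
  fix n :: nat and f :: "(nat \<Rightarrow> bool) \<Rightarrow> bool" and col :: coloring
  define N where "N = {..<n}"
  define F :: "nat set \<Rightarrow> real" where "F = (\<lambda>X. of_bool (f (cube_point n X)))"
  define edge where "edge i X = {cube_point n X, cube_point n (sym_diff X {i})}" for i X
  define red where "red i X \<longleftrightarrow> f (cube_point n X) \<and> \<not> f (cube_point n (sym_diff X {i})) \<and> col (edge i X) = Red" for i X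
  define blue where "blue i X \<longleftrightarrow> \<not> f (cube_point n X) \<and> f (cube_point n (sym_diff X {i})) \<and> col (edge i X) = Blue" for i X
  have flip2: "sym_diff (sym_diff X {i}) {i} = X" for i :: nat and X
    by auto
  \<comment> \<open>The colour belongs to the undirected edge, so both endpoints see the same one;
    the colour then decides which endpoint counts the edge.\<close>
  have edge_flip: "edge i (sym_diff X {i}) = edge i X" for i X
    by (simp only: edge_def flip2 insert_commute)
  interpret coloured_boolean_function N F red blue
  proof
    fix X i
    show "of_bool (red i X) - of_bool (red i (sym_diff X {i})) - of_bool (blue i X) + of_bool (blue i (sym_diff X {i}))
        = F X - F (sym_diff X {i})"
      unfolding red_def blue_def F_def edge_flip flip2
      by (cases "col (edge i X)") auto
  qed (auto simp: N_def F_def)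
  have "cube_expectation n (\<lambda>x. sqrt (real (red_sensitivity n col f x))) = gradient_norm N red"
    unfolding cube_expectation_eq_avg gradient_norm_def N_def
  proof (rule avg_cong)
    fix X assume X: "X \<subseteq> {..<n}"
    show "sqrt (real (red_sensitivity n col f (cube_point n X))) = sqrt (real (card {i\<in>{..<n}. red i X}))"
      unfolding red_sensitivity_def card_sensitive_edges_at[OF cube_point_in_cube[OF X]]
      by (auto simp: red_def edge_def flip_coord_cube_point intro!: arg_cong[where f = card])
  qed
  moreover have "cube_expectation n (\<lambda>x. sqrt (real (blue_sensitivity n col f x))) = gradient_norm N blue"
    unfolding cube_expectation_eq_avg gradient_norm_def N_def
  proof (rule avg_cong)
    fix X assume X: "X \<subseteq> {..<n}"
    show "sqrt (real (blue_sensitivity n col f (cube_point n X))) = sqrt (real (card {i\<in>{..<n}. blue i X}))"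
      unfolding blue_sensitivity_def card_sensitive_edges_at[OF cube_point_in_cube[OF X]]
      by (auto simp: blue_def edge_def flip_coord_cube_point intro!: arg_cong[where f = card])
  qed
  ultimately have T: "talagrand_col n col f = talagrand"
    by (simp add: talagrand_col_def talagrand_def)
  have V: "cube_var n f = cvar N F"
    by (simp add: cube_var_def cvar_def cube_expectation_eq_avg N_def F_def)
  have M: "(\<Sum>i<n. (influence n f i)\<^sup>2) = sq_influence N F"
    by (simp add: sq_influence_def N_def F_def influence_eq_avg)
  have T0: "0 \<le> talagrand"
    by (simp add: talagrand_def gradient_norm_nonneg)
  show "1 / 100 * cube_var n f * sqrt (log 2 (1 / cube_var n f)) \<le> talagrand_col n col f"
    unfolding T V using talagrand_ge_variance T0 by simp
  show "1 / 100 * cube_var n f * sqrt (log 2 (1 + 1 / (\<Sum>i<n. (influence n f i)\<^sup>2))) \<le> talagrand_col n col f"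
    unfolding T V M using talagrand_ge_influences by simp
qed simp

end
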